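(* For every $h\in(0,\pi/2)$ and $r>0$, the mapping $$\mathcal{N}(h,r)\ni\nu=\bigl((\lambda_n)_{n\in\mathbb{Z}},(\mu_n)_{n\in\mathbb{Z}}\bigr)\mapsto\boldsymbol\alpha=(\alpha_n)_{n\in\mathbb{Z}}\in\mathcal{A},\qquad \alpha_n=\frac{1}{\dot S(\lambda_n)\,C(\lambda_n)},$$ is analytic and Lipschitz continuous; moreover, there exist positive constants $h'$ and $r'$ such that the range of this mapping is contained in $\mathcal{A}(h',r')$.
   Context: Spectral data: $\mathcal{N}$ is the set of pairs of real sequences $\nu=\bigl((\lambda_n)_{n\in\mathbb{Z}},(\mu_n)_{n\in\mathbb{Z}}\bigr)$ such that $\lambda_n<\mu_n<\lambda_{n+1}$ for all $n\in\mathbb{Z}$ and the sequence $(\rho_k)_{k\in\mathbb{Z}}$, $\rho_{2n}:=\lambda_n-\pi n$, $\rho_{2n+1}:=\mu_n-\pi(n+\tfrac12)$, belongs to $\ell_2(\mathbb{Z})$. Identifying $\nu$ with $(\rho_k)$, $\mathcal{N}$ becomes a subset of real $\ell_2(\mathbb{Z})$ with the induced metric. $\mathcal{N}(h,r)$ is the set of $\nu\in\mathcal{N}$ that are $h$-separated, i.e. $\mu_n-\lambda_n\ge h$ and $\lambda_{n+1}-\mu_n\ge h$ for all $n\in\mathbb{Z}$, and satisfy $\|(\rho_k)\|_{\ell_2}\le r$. For $\nu\in\mathcal{N}$, the entire functions $S$ and $C$ are the canonical products $$S(z)=(z-\lambda_0)\lim_{N\to\infty}\prod_{\substack{n=-N\\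 n\neq0}}^{N}\frac{\lambda_n-z}{\pi n},\qquad C(z)=\lim_{N\to\infty}\prod_{n=-N}^{N}\frac{\mu_n-z}{\pi(n+\frac12)},$$ and $\dot S$ is the derivative of $S$ in $z$. (The numbers $\alpha_n$ are the norming constants of the Dirac operator on $[0,1]$ with the spectral data $\nu$.) $\mathcal{A}$ is the set of sequences $\boldsymbol\alpha=(\alpha_n)_{n\in\mathbb{Z}}$ of positive numbers such that $(\beta_n)$, $\beta_n:=\alpha_n-1$, belongs to $\ell_2(\mathbb{Z})$; it is identified with a subset of $\ell_2(\mathbb{Z})$ via $\boldsymbol\alpha\leftrightarrow(\beta_n)$ with the induced metric. $\mathcal{A}(h',r')$ is the set of $\boldsymbol\alpha\in\mathcal{A}$ with $\alpha_n\ge h'$ for all $n\in\mathbb{Z}$ and $\|(\beta_n)\|_{\ell_2}\le r'$. Convention: a mapping from a subset $M$ of a Banach space $X$ to a Banach space $Y$ (or, via identification, a subset of it) is analytic if near each point of $M$ it is the restriction to $M$ of a mapping, defined on an open neighbourhood in $X$ and valued in $Y$, that is given by a norm-convergent power series of bounded homogeneous polynomials. *)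

theory Defs
  imports "HOL-Analysis.Analysis"
begin

typedef 'i ell2 = "{x :: 'i \<Rightarrow> real. (\<lambda>i. (x i)\<^sup>2) summable_on UNIV}"
  morphisms ell2_nth Abs_ell2
  by (rule exI[of _ "\<lambda>_. 0"]) simp

setup_lifting type_definition_ell2

lemma sq_summable_scale:
  fixes x :: "'i \<Rightarrow> real"
  assumes "(\<lambda>i. (x i)\<^sup>2) summable_on UNIV"
  shows "(\<lambda>i. (c * x i)\<^sup>2) summable_on UNIV"
  using summable_on_cmult_right[OF assms, of "c\<^sup>2"] by (simp add: power_mult_distrib)

lemma sq_summable_add:
  fixes x y :: "'i \<Rightarrow> real"
  assumes "(\<lambda>i. (x i)\<^sup>2) summable_on UNIV" "(\<lambda>i. (y i)\<^sup>2) summable_on UNIV"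
  shows "(\<lambda>i. (x i + y i)\<^sup>2) summable_on UNIV"
proof (rule summable_on_comparison_test)
  show "(\<lambda>i. 2 * (x i)\<^sup>2 + 2 * (y i)\<^sup>2) summable_on UNIV"
    by (intro summable_on_add summable_on_cmult_right assms)
  show "(x i + y i)\<^sup>2 \<le> 2 * (x i)\<^sup>2 + 2 * (y i)\<^sup>2" for i
    using sum_squares_bound[of "x i" "y i"] by (simp add: power2_sum)
qed auto

lemma sq_summable_mult:
  fixes x y :: "'i \<Rightarrow> real"
  assumes "(\<lambda>i. (x i)\<^sup>2) summable_on UNIV" "(\<lambda>i. (y i)\<^sup>2) summable_on UNIV"
  shows "(\<lambda>i. x i * y i) summable_on UNIV"
proof -
  have "(\<lambda>i. (x i + (- 1) * y i)\<^sup>2) summable_on UNIV"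
    by (rule sq_summable_add[OF assms(1) sq_summable_scale[OF assms(2)]])
  then have "(\<lambda>i. (1/4) * (x i + y i)\<^sup>2 + (- 1/4) * (x i + (- 1) * y i)\<^sup>2) summable_on UNIV"
    by (rule summable_on_add[OF summable_on_cmult_right[OF sq_summable_add[OF assms]]
          summable_on_cmult_right])
  moreover have "(1/4) * (x i + y i)\<^sup>2 + (- 1/4) * (x i + (- 1) * y i)\<^sup>2 = x i * y i" for i
    by (simp add: power2_eq_square algebra_simps)
  ultimately show ?thesis by simp
qed

instantiation ell2 :: (type) real_vector
begin

lift_definition zero_ell2 :: "'a ell2" is "\<lambda>_. 0" by simp

lift_definition plus_ell2 :: "'a ell2 \<Rightarrow> 'a ell2 \<Rightarrow> 'a ell2" is "\<lambda>x y i. x i + y i"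
  by (rule sq_summable_add)

lift_definition uminus_ell2 :: "'a ell2 \<Rightarrow> 'a ell2" is "\<lambda>x i. - x i" by simp

lift_definition minus_ell2 :: "'a ell2 \<Rightarrow> 'a ell2 \<Rightarrow> 'a ell2" is "\<lambda>x y i. x i - y i"
  using sq_summable_add[where y = "\<lambda>i. - y i" for y] by fastforce

lift_definition scaleR_ell2 :: "real \<Rightarrow> 'a ell2 \<Rightarrow> 'a ell2" is "\<lambda>c x i. c * x i"
  by (rule sq_summable_scale)

instance
proof
  fix x y z :: "'a ell2" and a b :: real
  show "x + y + z = x + (y + z)" by transfer (simp add: algebra_simps)
  show "x + y = y + x" by transfer (simp add: algebra_simps)
  show "0 + x = x" by transfer simp
  show "- x + x = 0" by transfer simp
  show "x - y = x + - y" by transfer simp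
  show "a *\<^sub>R (x + y) = a *\<^sub>R x + a *\<^sub>R y" by transfer (simp add: algebra_simps)
  show "(a + b) *\<^sub>R x = a *\<^sub>R x + b *\<^sub>R x" by transfer (simp add: algebra_simps)
  show "a *\<^sub>R b *\<^sub>R x = (a * b) *\<^sub>R x" by transfer (simp add: algebra_simps)
  show "1 *\<^sub>R x = x" by transfer simp
qed

end

instantiation ell2 :: (type) real_inner
begin

lift_definition inner_ell2 :: "'a ell2 \<Rightarrow> 'a ell2 \<Rightarrow> real" is
  "\<lambda>x y. \<Sum>\<^sub>\<infinity>i. x i * y i" .

lift_definition norm_ell2 :: "'a ell2 \<Rightarrow> real" is
  "\<lambda>x. sqrt (\<Sum>\<^sub>\<infinity>i. (x i)\<^sup>2)" .

definition dist_ell2 :: "'a ell2 \<Rightarrow> 'a ell2 \<Rightarrow> real" where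
  "dist_ell2 x y = norm (x - y)"

definition sgn_ell2 :: "'a ell2 \<Rightarrow> 'a ell2" where
  "sgn_ell2 x = x /\<^sub>R norm x"

definition uniformity_ell2 :: "('a ell2 \<times> 'a ell2) filter" where
  "uniformity_ell2 = (INF e\<in>{0<..}. principal {(x, y). dist x y < e})"

definition open_ell2 :: "'a ell2 set \<Rightarrow> bool" where
  "open_ell2 U = (\<forall>x\<in>U. \<forall>\<^sub>F (x', y) in uniformity. x' = x \<longrightarrow> y \<in> U)"

instance
proof
  fix x y z :: "'a ell2" and a b :: real
  show "dist x y = norm (x - y)" by (rule dist_ell2_def)
  show "sgn x = x /\<^sub>R norm x" by (rule sgn_ell2_def)
  show "uniformity = (INF e\<in>{0<..}. principal {(x :: 'a ell2, y). dist x y < e})"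
    by (rule uniformity_ell2_def)
  show "open U = (\<forall>x\<in>U. \<forall>\<^sub>F (x', y) in uniformity. x' = x \<longrightarrow> y \<in> U)" for U :: "'a ell2 set"
    by (rule open_ell2_def)
  show "inner x y = inner y x" by transfer (simp add: mult.commute)
  show "inner (x + y) z = inner x z + inner y z"
    by transfer (simp add: distrib_right infsum_add sq_summable_mult)
  show "inner (a *\<^sub>R x) y = a * inner x y"
    by transfer (simp add: mult.assoc infsum_cmult_right')
  show "0 \<le> inner x x" by transfer (simp add: infsum_nonneg)
  show "inner x x = 0 \<longleftrightarrow> x = 0"
  proof transfer
    fix x :: "'a \<Rightarrow> real" assume *: "(\<lambda>i. (x i)\<^sup>2) summable_on UNIV"
    show "(\<Sum>\<^sub>\<infinity>i. x i * x i) = 0 \<longleftrightarrow> x = (\<lambda>_. 0)"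
      using nonneg_infsum_le_0D[OF _ *] by (auto simp flip: power2_eq_square)
  qed
  show "norm x = sqrt (inner x x)" by transfer (simp add: power2_eq_square)
qed

end

lemma ell2_nth_le_norm: "\<bar>ell2_nth x i\<bar> \<le> norm x"
proof transfer
  fix x :: "'a \<Rightarrow> real" and i assume *: "(\<lambda>i. (x i)\<^sup>2) summable_on UNIV"
  have "(\<Sum>j\<in>{i}. (x j)\<^sup>2) \<le> (\<Sum>\<^sub>\<infinity>j. (x j)\<^sup>2)"
    by (rule finite_sum_le_infsum[OF *]) auto
  then show "\<bar>x i\<bar> \<le> sqrt (\<Sum>\<^sub>\<infinity>j. (x j)\<^sup>2)"
    by (simp add: real_le_rsqrt)
qed

lemma ell2_finite_sum_le_norm: "finite F \<Longrightarrow> (\<Sum>i\<in>F. (ell2_nth x i)\<^sup>2) \<le> (norm x)\<^sup>2"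
proof transfer
  fix x :: "'a \<Rightarrow> real" and F assume "(\<lambda>i. (x i)\<^sup>2) summable_on UNIV" "finite (F :: 'a set)"
  then have "(\<Sum>i\<in>F. (x i)\<^sup>2) \<le> (\<Sum>\<^sub>\<infinity>i. (x i)\<^sup>2)"
    by (intro finite_sum_le_infsum) auto
  then show "(\<Sum>i\<in>F. (x i)\<^sup>2) \<le> (sqrt (\<Sum>\<^sub>\<infinity>i. (x i)\<^sup>2))\<^sup>2"
    by (simp add: infsum_nonneg)
qed

instance ell2 :: (type) banach
proof
  fix X :: "nat \<Rightarrow> 'a ell2" assume X: "Cauchy X"
  have "Cauchy (\<lambda>n. ell2_nth (X n) i)" for i
  proof (rule metric_CauchyI)
    fix e :: real assume "e > 0"
    with X obtain M where M: "\<And>m n. m \<ge> M \<Longrightarrow> n \<ge> M \<Longrightarrow> dist (X m) (X n) < e"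
      unfolding Cauchy_def by metis
    have "dist (ell2_nth (X m) i) (ell2_nth (X n) i) \<le> dist (X m) (X n)" for m n
      using ell2_nth_le_norm[of "X m - X n" i] by (simp add: dist_norm minus_ell2.rep_eq)
    then show "\<exists>M. \<forall>m\<ge>M. \<forall>n\<ge>M. dist (ell2_nth (X m) i) (ell2_nth (X n) i) < e"
      using M le_less_trans by blast
  qed
  then have "\<exists>l. (\<lambda>n. ell2_nth (X n) i) \<longlonglongrightarrow> l" for i
    by (simp add: Cauchy_convergent_iff convergent_def)
  then obtain l where l: "\<And>i. (\<lambda>n. ell2_nth (X n) i) \<longlonglongrightarrow> l i" by metis
  have bound: "(\<Sum>i\<in>F. (ell2_nth (X m) i - l i)\<^sup>2) \<le> e\<^sup>2"
    if "finite F" and M: "\<And>n. n \<ge> M \<Longrightarrow> dist (X m) (X n) < e" for F m M and e :: real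
  proof (rule LIMSEQ_le_const2)
    show "(\<lambda>n. \<Sum>i\<in>F. (ell2_nth (X m) i - ell2_nth (X n) i)\<^sup>2)
            \<longlonglongrightarrow> (\<Sum>i\<in>F. (ell2_nth (X m) i - l i)\<^sup>2)"
      by (intro tendsto_intros l)
    have "(\<Sum>i\<in>F. (ell2_nth (X m) i - ell2_nth (X n) i)\<^sup>2) \<le> e\<^sup>2" if "n \<ge> M" for n
    proof -
      have "(\<Sum>i\<in>F. (ell2_nth (X m) i - ell2_nth (X n) i)\<^sup>2) \<le> (norm (X m - X n))\<^sup>2"
        using ell2_finite_sum_le_norm[OF \<open>finite F\<close>, of "X m - X n"]
        by (simp add: minus_ell2.rep_eq)
      also have "\<dots> \<le> e\<^sup>2"
        using M[OF that] by (intro power_mono) (auto simp: dist_norm)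
      finally show ?thesis .
    qed
    then show "\<exists>N. \<forall>n\<ge>N. (\<Sum>i\<in>F. (ell2_nth (X m) i - ell2_nth (X n) i)\<^sup>2) \<le> e\<^sup>2" by blast
  qed
  have summ: "(\<lambda>i. (ell2_nth (X m) i - l i)\<^sup>2) summable_on UNIV"
    if "\<And>n. n \<ge> M \<Longrightarrow> dist (X m) (X n) < e" for m M e
    by (rule nonneg_bdd_above_summable_on) (auto intro!: bdd_aboveI2[where M = "e\<^sup>2"] bound that)
  obtain M where "\<And>n. n \<ge> M \<Longrightarrow> dist (X M) (X n) < 1"
    using metric_CauchyD[OF X zero_less_one] by blast
  from summ[OF this] have s1: "(\<lambda>i. (ell2_nth (X M) i - l i)\<^sup>2) summable_on UNIV" by simp
  have "(\<lambda>i. (ell2_nth (X M) i + (- 1) * (ell2_nth (X M) i - l i))\<^sup>2) summable_on UNIV"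
    using ell2_nth[of "X M"] by (intro sq_summable_add sq_summable_scale s1) simp
  then have l2: "(\<lambda>i. (l i)\<^sup>2) summable_on UNIV" by simp
  have "X \<longlonglongrightarrow> Abs_ell2 l"
  proof (rule metric_LIMSEQ_I)
    fix e :: real assume "e > 0"
    then obtain M where M: "\<And>m n. m \<ge> M \<Longrightarrow> n \<ge> M \<Longrightarrow> dist (X m) (X n) < e / 2"
      using metric_CauchyD[OF X, of "e / 2"] by auto
    have "dist (X m) (Abs_ell2 l) < e" if "m \<ge> M" for m
    proof -
      have "(\<Sum>\<^sub>\<infinity>i. (ell2_nth (X m) i - l i)\<^sup>2) \<le> (e / 2)\<^sup>2"
        using that M by (intro infsum_le_finite_sums summ bound) blast+
      then have "sqrt (\<Sum>\<^sub>\<infinity>i. (ell2_nth (X m) i - l i)\<^sup>2) \<le> e / 2"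
        using \<open>e > 0\<close> by (intro real_le_lsqrt) auto
      then have "norm (X m - Abs_ell2 l) \<le> e / 2"
        using l2 by (simp add: norm_ell2.rep_eq minus_ell2.rep_eq Abs_ell2_inverse)
      then show ?thesis using \<open>e > 0\<close> by (simp add: dist_norm)
    qed
    then show "\<exists>M. \<forall>m\<ge>M. dist (X m) (Abs_ell2 l) < e" by blast
  qed
  then show "convergent X" by (auto simp: convergent_def)
qed

text \<open>A \<open>k\<close>-linear map is encoded as a function of a sequence \<open>x\<close> that depends only on the entries
  \<open>x 0, \<dots>, x (k - 1)\<close>; for \<open>k = 0\<close> it is a constant.\<close>

definition bounded_multilinear ::
    "nat \<Rightarrow> ((nat \<Rightarrow> 'a::real_normed_vector) \<Rightarrow> 'b::real_normed_vector) \<Rightarrow> bool" where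
  "bounded_multilinear k A \<longleftrightarrow>
     (\<forall>x y. (\<forall>i<k. x i = y i) \<longrightarrow> A x = A y) \<and>
     (\<forall>i<k. \<forall>x. linear (\<lambda>v. A (x(i := v)))) \<and>
     (\<exists>K. \<forall>x. norm (A x) \<le> K * (\<Prod>i<k. norm (x i)))"

definition bounded_homogeneous_poly ::
    "nat \<Rightarrow> ('a::real_normed_vector \<Rightarrow> 'b::real_normed_vector) \<Rightarrow> bool" where
  "bounded_homogeneous_poly k P \<longleftrightarrow>
     (\<exists>A. bounded_multilinear k A \<and> (\<forall>v. P v = A (\<lambda>_. v)))"

definition poly_norm :: "('a::real_normed_vector \<Rightarrow> 'b::real_normed_vector) \<Rightarrow> real" where
  "poly_norm P = (SUP v\<in>cball 0 1. norm (P v))"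

text \<open>Norm convergence of the power series is required in the form
  \<open>\<Sum>k. \<parallel>P k\<parallel> * \<delta> ^ k < \<infinity>\<close>. Up to shrinking \<open>\<delta>\<close> this is the same as convergence of the
  series at every point of the ball.\<close>

definition power_series_on_ball ::
    "('a::banach \<Rightarrow> 'b::banach) \<Rightarrow> 'a \<Rightarrow> real \<Rightarrow> bool" where
  "power_series_on_ball F a \<delta> \<longleftrightarrow>
     (\<exists>P. (\<forall>k. bounded_homogeneous_poly k (P k)) \<and>
          summable (\<lambda>k. poly_norm (P k) * \<delta> ^ k) \<and>
          (\<forall>x\<in>ball a \<delta>. (\<lambda>k. P k (x - a)) sums F x))"

text \<open>Here \<open>M\<close> need not be open: near each of its points, the map has to be the restriction of
  a convergent power series living on a full ball of the ambient space.\<close>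

definition analytic_map_on :: "'a::banach set \<Rightarrow> ('a \<Rightarrow> 'b::banach) \<Rightarrow> bool" where
  "analytic_map_on M f \<longleftrightarrow>
     (\<forall>a\<in>M. \<exists>\<delta>>0. \<exists>F. power_series_on_ball F a \<delta> \<and> (\<forall>x\<in>M \<inter> ball a \<delta>. f x = F x))"

type_synonym spectral_pair = "(int \<Rightarrow> real) \<times> (int \<Rightarrow> real)"

definition rho_seq :: "spectral_pair \<Rightarrow> int \<Rightarrow> real" where
  "rho_seq \<nu> k =
     (if even k then fst \<nu> (k div 2) - pi * of_int (k div 2)
      else snd \<nu> (k div 2) - pi * (of_int (k div 2) + 1 / 2))"

definition spectral_data :: "spectral_pair set" where
  "spectral_data =
     {\<nu>. (\<forall>n. fst \<nu> n < snd \<nu> n \<and> snd \<nu> n < fst \<nu> (n + 1)) \<and>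
         (\<lambda>k. (rho_seq \<nu> k)\<^sup>2) summable_on UNIV}"

text \<open>The identification of spectral data with elements of the sequence space; \<^const>\<open>Abs_ell2\<close>
  is only meaningful on square-summable families, so this is to be used on
  \<^const>\<open>spectral_data\<close> only.\<close>

definition spectral_ell2 :: "spectral_pair \<Rightarrow> int ell2" where
  "spectral_ell2 \<nu> = Abs_ell2 (rho_seq \<nu>)"

definition separated_spectral_data :: "real \<Rightarrow> real \<Rightarrow> spectral_pair set" where
  "separated_spectral_data h r =
     {\<nu> \<in> spectral_data.
        (\<forall>n. snd \<nu> n - fst \<nu> n \<ge> h \<and> fst \<nu> (n + 1) - snd \<nu> n \<ge> h) \<and>
        norm (spectral_ell2 \<nu>) \<le> r}"

lemma rho_seq_even: "rho_seq \<nu> (2 * n) = fst \<nu> n - pi * of_int n"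
  by (simp add: rho_seq_def)

lemma rho_seq_odd: "rho_seq \<nu> (2 * n + 1) = snd \<nu> n - pi * (of_int n + 1 / 2)"
  by (simp add: rho_seq_def)

lemma inj_on_spectral_ell2: "inj_on spectral_ell2 spectral_data"
proof (rule inj_onI)
  fix \<nu> \<nu>' assume "\<nu> \<in> spectral_data" "\<nu>' \<in> spectral_data" "spectral_ell2 \<nu> = spectral_ell2 \<nu>'"
  then have eq: "rho_seq \<nu> = rho_seq \<nu>'"
    by (simp add: spectral_ell2_def spectral_data_def Abs_ell2_inject)
  have "fst \<nu> n = fst \<nu>' n" "snd \<nu> n = snd \<nu>' n" for n
    using fun_cong[OF eq, of "2 * n"] fun_cong[OF eq, of "2 * n + 1"]
    by (simp_all add: rho_seq_even rho_seq_odd)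
  then show "\<nu> = \<nu>'" by (simp add: prod_eq_iff fun_eq_iff)
qed

definition S_fun :: "spectral_pair \<Rightarrow> complex \<Rightarrow> complex" where
  "S_fun \<nu> z = (z - of_real (fst \<nu> 0)) *
     lim (\<lambda>N::nat. \<Prod>n\<in>{- int N..int N} - {0}. (of_real (fst \<nu> n) - z) / of_real (pi * of_int n))"

definition C_fun :: "spectral_pair \<Rightarrow> complex \<Rightarrow> complex" where
  "C_fun \<nu> z =
     lim (\<lambda>N::nat. \<Prod>n\<in>{- int N..int N}.
            (of_real (snd \<nu> n) - z) / of_real (pi * (of_int n + 1 / 2)))"

definition norming_const :: "spectral_pair \<Rightarrow> int \<Rightarrow> complex" where
  "norming_const \<nu> n =
     1 / (deriv (S_fun \<nu>) (of_real (fst \<nu> n)) * C_fun \<nu> (of_real (fst \<nu> n)))"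

text \<open>The norming constants are real although \<^const>\<open>S_fun\<close> and \<^const>\<open>C_fun\<close> are functions of a
  complex variable; taking the real part only changes the type.\<close>

definition norming_seq :: "spectral_pair \<Rightarrow> int \<Rightarrow> real" where
  "norming_seq \<nu> n = Re (norming_const \<nu> n)"

definition norming_sequences :: "(int \<Rightarrow> real) set" where
  "norming_sequences = {\<alpha>. (\<forall>n. \<alpha> n > 0) \<and> (\<lambda>n. (\<alpha> n - 1)\<^sup>2) summable_on UNIV}"

text \<open>As with \<^const>\<open>spectral_ell2\<close>, only meaningful on \<^const>\<open>norming_sequences\<close>.\<close>

definition norming_ell2 :: "(int \<Rightarrow> real) \<Rightarrow> int ell2" where
  "norming_ell2 \<alpha> = Abs_ell2 (\<lambda>n. \<alpha> n - 1)"

definition bounded_norming_sequences :: "real \<Rightarrow> real \<Rightarrow> (int \<Rightarrow> real) set" where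
  "bounded_norming_sequences h' r' =
     {\<alpha> \<in> norming_sequences. (\<forall>n. \<alpha> n \<ge> h') \<and> norm (norming_ell2 \<alpha>) \<le> r'}"

text \<open>The map from spectral data to norming constants, read through the two identifications as a map
  between subsets of the sequence space.\<close>

definition norming_map_ell2 :: "int ell2 \<Rightarrow> int ell2" where
  "norming_map_ell2 = norming_ell2 \<circ> norming_seq \<circ> inv_into spectral_data spectral_ell2"

lemma norming_map_ell2_spectral_ell2:
  "\<nu> \<in> spectral_data \<Longrightarrow> norming_map_ell2 (spectral_ell2 \<nu>) = norming_ell2 (norming_seq \<nu>)"
  by (simp add: norming_map_ell2_def inv_into_f_f inj_on_spectral_ell2)

end

theory Submission
  imports Defs "HOL-Complex_Analysis.Complex_Analysis" "HOL-Real_Asymp.Real_Asymp"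
begin

text \<open>
  Interleave the two spectral sequences into \<open>x (2 n) = \<lambda> n\<close>, \<open>x (2 n + 1) = \<mu> n\<close>, so that
  \<open>x k = \<pi> k / 2 + \<rho> k\<close>. In the partial products of \<open>S\<close> and \<open>C\<close> remove the factor that vanishes at
  \<open>\<lambda> n\<close> and compare what is left with the same expression for \<open>\<rho> = 0\<close>, where \<open>S = sin\<close> and
  \<open>C = cos\<close>. With \<open>j = 2 n\<close> this gives
  \<open>1 / \<alpha> n = S' (\<lambda> n) C (\<lambda> n) = lim (\<Prod>k. 1 + u j k)\<close>, where
  \<open>u j k = (2 / \<pi>) (\<rho> k - \<rho> j) / (k - j)\<close> and \<open>k\<close> runs through growing symmetric windows. Separation
  says exactly what is needed of the factors: \<open>1 + u j k \<ge> 2 h / \<pi>\<close>. So \<open>\<alpha> n = exp (- f (2 n))\<close>, where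
  \<open>f j\<close> is the sum of the \<open>ln (1 + u j k)\<close>.

  In general the sum is only conditionally convergent. Write \<open>ln (1 + u) = u + \<phi> u\<close>. In the sum of the linear
  terms the contribution of \<open>\<rho> j\<close> cancels, because \<open>\<Sum>k. 1 / (k - j)\<close> vanishes as a principal value,
  and what remains is the discrete Hilbert transform of \<open>\<rho>\<close>, a bounded operator on \<open>\<ell>\<^sub>2\<close>. The defect
  \<open>\<phi> u\<close> is of second order in \<open>u\<close>. Since \<open>u\<close> is a square-summable matrix that depends linearly on
  \<open>\<rho>\<close>, and since the row-wise inner product of two square-summable matrices lies in \<open>\<ell>\<^sub>2\<close>, the rest
  \<open>\<Sum>k. \<phi> (u j k)\<close> is again an \<open>\<ell>\<^sub>2\<close> sequence, and so is \<open>f\<close>.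

  Factoring \<open>\<phi> u - \<phi> u' = (u - u') q\<close> with \<open>q\<close> square-summable yields the Lipschitz estimate for \<open>f\<close>
  on bounded sets of separated data (lemma \<open>log_product_difference\<close>); the bounds for \<open>\<alpha>\<close> follow since
  \<open>f\<close> is bounded there and \<open>f = 0\<close> at \<open>\<rho> = 0\<close>. For analyticity, \<open>1 + u (a + v) = (1 + u a) (1 + t)\<close>
  with \<open>t\<close> linear in \<open>v\<close>, so \<open>f (a + v) - f a\<close> is the Hilbert transform plus a row-wise inner
  product of \<open>t\<close> with \<open>- u a\<close> plus a scalar power series applied to every entry of \<open>t\<close> (lemma
  \<open>log_product_power_series\<close>). A small calculus of power series with majorants, closed under bounded
  bilinear maps and absolutely convergent sums, turns this expression and its exponential into
  norm-convergent power series.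
\<close>

section \<open>Majorised power series\<close>

text \<open>
  The bound is a parameter because sums of infinitely many multilinear maps require their bounds to be
  summable.
\<close>

definition bounded_multilinear_le ::
    "nat \<Rightarrow> real \<Rightarrow> ((nat \<Rightarrow> 'a::real_normed_vector) \<Rightarrow> 'b::real_normed_vector) \<Rightarrow> bool" where
  "bounded_multilinear_le k c A \<longleftrightarrow>
     (\<forall>x y. (\<forall>i<k. x i = y i) \<longrightarrow> A x = A y) \<and>
     (\<forall>i<k. \<forall>x. linear (\<lambda>v. A (x(i := v)))) \<and>
     0 \<le> c \<and> (\<forall>x. norm (A x) \<le> c * (\<Prod>i<k. norm (x i)))"

text \<open>
  The terms of the series carry an arbitrary numbering, the \<open>i\<close>-th one being homogeneous of degree
  \<open>d i\<close>. In this form products and infinite sums of series only require a renumbering of pairs, and terms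
  of equal degree are collected once, at the very end. The bound \<open>K\<close> limits the majorant at
  \<open>\<delta>\<close>, a norm on series that is subadditive and submultiplicative.
\<close>

definition power_series_le ::
    "('a::real_normed_vector \<Rightarrow> 'b::real_normed_vector) \<Rightarrow> real \<Rightarrow> real \<Rightarrow> bool" where
  "power_series_le F \<delta> K \<longleftrightarrow>
     (\<exists>d T c. (\<forall>i::nat. bounded_multilinear_le (d i) (c i) (T i)) \<and>
        (\<exists>s\<le>K. ((\<lambda>i. c i * \<delta> ^ d i) has_sum s) UNIV) \<and>
        (\<forall>v. norm v < \<delta> \<longrightarrow> ((\<lambda>i. T i (\<lambda>_. v)) has_sum F v) UNIV))"

lemma bounded_multilinear_le_nonneg: "bounded_multilinear_le k c A \<Longrightarrow> 0 \<le> c"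
  by (simp add: bounded_multilinear_le_def)

lemma bounded_multilinear_le_zero: "bounded_multilinear_le k 0 (\<lambda>_. 0)"
  by (auto simp: bounded_multilinear_le_def intro: linearI)

lemma bounded_multilinear_le_diagonal:
  assumes "bounded_multilinear_le k c A" and "norm v \<le> \<delta>"
  shows "norm (A (\<lambda>_. v)) \<le> c * \<delta> ^ k"
proof -
  have "norm (A (\<lambda>_. v)) \<le> c * (\<Prod>i<k. norm v)"
    using assms(1) unfolding bounded_multilinear_le_def by (elim conjE) (drule spec, assumption)
  also have "\<dots> \<le> c * \<delta> ^ k"
    using assms by (auto simp: bounded_multilinear_le_def intro!: mult_left_mono power_mono)
  finally show ?thesis .
qed

lemma power_series_le_single:
  assumes A: "bounded_multilinear_le k c A" and "c * \<delta> ^ k \<le> K" and F: "\<And>v. F v = A (\<lambda>_. v)"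
  shows "power_series_le F \<delta> K"
proof -
  define T where "T i = (if i = 0 then A else (\<lambda>_. 0))" for i :: nat
  define C where "C i = (if i = 0 then c else 0)" for i :: nat
  have "((\<lambda>i. C i * \<delta> ^ k) has_sum c * \<delta> ^ k) UNIV"
    by (rule has_sum_finite_neutralI[of "{0}"]) (auto simp: C_def)
  moreover have "((\<lambda>i. T i (\<lambda>_. v)) has_sum F v) UNIV" for v
    by (rule has_sum_finite_neutralI[of "{0}"]) (auto simp: T_def F)
  moreover have "bounded_multilinear_le k (C i) (T i)" for i
    by (simp add: C_def T_def A bounded_multilinear_le_zero)
  ultimately show ?thesis
    unfolding power_series_le_def using assms(2)
    by (intro exI[of _ "\<lambda>_. k"] exI[of _ T] exI[of _ C]) blast
qed

lemma power_series_le_const: "power_series_le (\<lambda>_. b) \<delta> (norm b)"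
  by (rule power_series_le_single[of 0 "norm b" "\<lambda>_. b"]) (auto simp: bounded_multilinear_le_def)

lemma power_series_le_linear:
  assumes T: "linear T" and le: "\<And>v. norm (T v) \<le> C * norm v" and "0 \<le> C"
  shows "power_series_le T \<delta> (C * \<delta>)"
proof (rule power_series_le_single[of 1 C "\<lambda>x. T (x 0)"])
  show "bounded_multilinear_le 1 C (\<lambda>x. T (x 0))"
    using T le \<open>0 \<le> C\<close> by (auto simp: bounded_multilinear_le_def)
qed auto

text \<open>
  The double family of all terms is dominated by a double family with sum at most \<open>\<Sum>m. K m\<close>, so it may
  be summed in any order, in particular along an enumeration of the pairs.
\<close>

lemma power_series_le_infsum:
  fixes F :: "nat \<Rightarrow> 'a::banach \<Rightarrow> 'b::banach"
  assumes F: "\<And>m. power_series_le (F m) \<delta> (K m)" and K: "K summable_on UNIV" and "0 < \<delta>"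
  shows "power_series_le (\<lambda>v. \<Sum>\<^sub>\<infinity>m. F m v) \<delta> (\<Sum>\<^sub>\<infinity>m. K m)"
proof -
  have "\<forall>m. \<exists>d T c s. (\<forall>i. bounded_multilinear_le (d i) (c i) (T i)) \<and> s \<le> K m \<and>
      ((\<lambda>i. c i * \<delta> ^ d i) has_sum s) (UNIV :: nat set) \<and>
      (\<forall>v. norm v < \<delta> \<longrightarrow> ((\<lambda>i. T i (\<lambda>_. v)) has_sum F m v) UNIV)"
  proof
    fix m
    from F[of m] obtain d T c s where "\<forall>i. bounded_multilinear_le (d i) (c i) (T i)"
      "s \<le> K m" "((\<lambda>i. c i * \<delta> ^ d i) has_sum s) (UNIV :: nat set)"
      "\<forall>v. norm v < \<delta> \<longrightarrow> ((\<lambda>i. T i (\<lambda>_. v)) has_sum F m v) UNIV"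
      unfolding power_series_le_def by blast
    then show "\<exists>d T c s. (\<forall>i. bounded_multilinear_le (d i) (c i) (T i)) \<and> s \<le> K m \<and>
      ((\<lambda>i. c i * \<delta> ^ d i) has_sum s) (UNIV :: nat set) \<and>
      (\<forall>v. norm v < \<delta> \<longrightarrow> ((\<lambda>i. T i (\<lambda>_. v)) has_sum F m v) UNIV)" by blast
  qed
  then obtain d T c s where dTcs:
      "\<forall>m. (\<forall>i. bounded_multilinear_le (d m i) (c m i) (T m i)) \<and> s m \<le> K m \<and>
        ((\<lambda>i. c m i * \<delta> ^ d m i) has_sum s m) (UNIV :: nat set) \<and>
        (\<forall>v. norm v < \<delta> \<longrightarrow> ((\<lambda>i. T m i (\<lambda>_. v)) has_sum F m v) UNIV)"
    unfolding choice_iff by blast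
  have T: "bounded_multilinear_le (d m i) (c m i) (T m i)"
    and s: "s m \<le> K m" "((\<lambda>i. c m i * \<delta> ^ d m i) has_sum s m) (UNIV :: nat set)"
    and sumF: "norm v < \<delta> \<Longrightarrow> ((\<lambda>i. T m i (\<lambda>_. v)) has_sum F m v) UNIV" for m i v
    using dTcs by blast+
  have c0: "0 \<le> c m i" for m i by (rule bounded_multilinear_le_nonneg[OF T])
  have s0: "0 \<le> s m" for m
    by (rule has_sum_nonneg[OF s(2)]) (use c0 \<open>0 < \<delta>\<close> in auto)
  have s_summable: "s summable_on UNIV"
    by (rule summable_on_comparison_test[OF K]) (use s s0 in auto)
  have dom: "(\<lambda>(m, i). c m i * \<delta> ^ d m i) summable_on UNIV \<times> UNIV"
    by (rule summable_on_SigmaI[where g = s]) (use s s_summable c0 \<open>0 < \<delta>\<close> in auto)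
  have sum_dom: "((\<lambda>(m, i). c m i * \<delta> ^ d m i) has_sum (\<Sum>\<^sub>\<infinity>m. s m)) (UNIV \<times> UNIV)"
    by (rule has_sum_SigmaI[where g = s]) (use s s_summable dom in auto)
  have sum_all: "((\<lambda>(m, i). T m i (\<lambda>_. v)) has_sum (\<Sum>\<^sub>\<infinity>m. F m v)) (UNIV \<times> UNIV)"
    if v: "norm v < \<delta>" for v
  proof -
    have "(\<lambda>(m, i). T m i (\<lambda>_. v)) abs_summable_on UNIV \<times> UNIV"
      by (rule Infinite_Sum.abs_summable_on_comparison_test'[OF dom])
         (use v bounded_multilinear_le_diagonal[OF T] in \<open>auto split: prod.splits intro: less_imp_le\<close>)
    then have *: "(\<lambda>(m, i). T m i (\<lambda>_. v)) summable_on UNIV \<times> UNIV"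
      by (rule abs_summable_summable)
    have "(\<Sum>\<^sub>\<infinity>m. F m v) = (\<Sum>\<^sub>\<infinity>m. \<Sum>\<^sub>\<infinity>i. T m i (\<lambda>_. v))"
      by (intro infsum_cong infsumI[symmetric] sumF v)
    also have "\<dots> = infsum (\<lambda>(m, i). T m i (\<lambda>_. v)) (UNIV \<times> UNIV)"
      by (rule infsum_Sigma'_banach[OF *])
    finally show ?thesis
      using has_sum_infsum[OF *] by simp
  qed
  define dec where "dec = prod_decode"
  have bij: "bij_betw dec UNIV (UNIV \<times> UNIV)"
    using bij_prod_decode by (simp add: dec_def)
  show ?thesis
    unfolding power_series_le_def
  proof (intro exI conjI allI impI)
    fix i and v :: 'a
    show "bounded_multilinear_le (case dec i of (m, i) \<Rightarrow> d m i)
        (case dec i of (m, i) \<Rightarrow> c m i) (case dec i of (m, i) \<Rightarrow> T m i)"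
      using T by (auto split: prod.splits)
    show "(\<Sum>\<^sub>\<infinity>m. s m) \<le> (\<Sum>\<^sub>\<infinity>m. K m)"
      by (rule infsum_mono[OF s_summable K s(1)])
    show "((\<lambda>i. (case dec i of (m, i) \<Rightarrow> c m i) * \<delta> ^ (case dec i of (m, i) \<Rightarrow> d m i))
        has_sum (\<Sum>\<^sub>\<infinity>m. s m)) UNIV"
      using has_sum_reindex_bij_betw[OF bij, THEN iffD2, OF sum_dom]
      by (simp add: case_prod_unfold)
    assume "norm v < \<delta>"
    from has_sum_reindex_bij_betw[OF bij, THEN iffD2, OF sum_all[OF this]]
    show "((\<lambda>i. (case dec i of (m, i) \<Rightarrow> T m i) (\<lambda>_. v)) has_sum (\<Sum>\<^sub>\<infinity>m. F m v)) UNIV"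
      by (simp add: case_prod_unfold)
  qed
qed

lemma power_series_le_mono:
  assumes "power_series_le F \<delta> K" and "K \<le> K'"
  shows "power_series_le F \<delta> K'"
  using assms(1) order_trans[OF _ assms(2)] unfolding power_series_le_def by blast

lemma power_series_le_cong:
  assumes "power_series_le F \<delta> K" and "\<And>v. norm v < \<delta> \<Longrightarrow> F v = G v"
  shows "power_series_le G \<delta> K"
proof -
  have "((\<lambda>i. T i (\<lambda>_. v)) has_sum F v) UNIV \<longleftrightarrow> ((\<lambda>i. T i (\<lambda>_. v)) has_sum G v) UNIV"
    if "norm v < \<delta>" for v and T :: "nat \<Rightarrow> (nat \<Rightarrow> 'a) \<Rightarrow> 'b"
    using assms(2)[OF that] by simp
  with assms(1) show ?thesis unfolding power_series_le_def by blast
qed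

lemma power_series_le_bound:
  assumes "power_series_le F \<delta> K" and "norm v < \<delta>"
  shows "norm (F v) \<le> K"
proof -
  obtain d T c s where T: "\<And>i. bounded_multilinear_le (d i) (c i) (T i)"
    and s: "s \<le> K" "((\<lambda>i. c i * \<delta> ^ d i) has_sum s) (UNIV :: nat set)"
    and F: "((\<lambda>i. T i (\<lambda>_. v)) has_sum F v) UNIV"
    using assms unfolding power_series_le_def by blast
  have "norm (F v) \<le> s"
    by (rule norm_infsum_le[OF F s(2)])
       (use bounded_multilinear_le_diagonal[OF T] assms(2) in \<open>auto intro: less_imp_le\<close>)
  with s show ?thesis by simp
qed

lemma power_series_le_add:
  fixes F G :: "'a::banach \<Rightarrow> 'b::banach"
  assumes "power_series_le F \<delta> K" and "power_series_le G \<delta> K'" and "0 < \<delta>"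
  shows "power_series_le (\<lambda>v. F v + G v) \<delta> (K + K')"
proof -
  define H where "H m = (if m = 0 then F else if m = 1 then G else (\<lambda>_. 0))" for m :: nat
  define L where "L m = (if m = 0 then K else if m = 1 then K' else 0)" for m :: nat
  have L: "(L has_sum (K + K')) UNIV"
    by (rule has_sum_finite_neutralI[of "{0, 1}"]) (auto simp: L_def)
  have H: "((\<lambda>m. H m v) has_sum (F v + G v)) UNIV" for v
    by (rule has_sum_finite_neutralI[of "{0, 1}"]) (auto simp: H_def)
  have "power_series_le (H m) \<delta> (L m)" for m
    using assms power_series_le_const[of 0 \<delta>] by (auto simp: H_def L_def)
  from power_series_le_infsum[OF this has_sum_imp_summable[OF L] \<open>0 < \<delta>\<close>] show ?thesis
    by (simp add: infsumI[OF L] infsumI[OF H])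
qed

text \<open>
  Pairing a single term of \<open>F\<close> with the whole series of \<open>G\<close> merely raises all degrees by the degree of
  that term; the value \<open>B (F v) (G v)\<close> is the sum of these series over all terms of \<open>F\<close>. The arguments of
  a product of a \<open>p\<close>-linear and a \<open>q\<close>-linear map are the first \<open>p\<close> entries and the next \<open>q\<close> entries.
\<close>

lemma power_series_le_bilinear:
  fixes F :: "'a::banach \<Rightarrow> 'b::banach" and G :: "'a \<Rightarrow> 'c::banach"
    and B :: "'b \<Rightarrow> 'c \<Rightarrow> 'd::banach"
  assumes F: "power_series_le F \<delta> K" and G: "power_series_le G \<delta> K'" and "0 < \<delta>"
    and B: "bounded_bilinear B" and B_le: "\<And>x y. norm (B x y) \<le> norm x * norm y"
  shows "power_series_le (\<lambda>v. B (F v) (G v)) \<delta> (K * K')"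
proof -
  interpret bounded_bilinear B by fact
  obtain d T c s where T: "\<And>i. bounded_multilinear_le (d i) (c i) (T i)"
    and s: "s \<le> K" "((\<lambda>i. c i * \<delta> ^ d i) has_sum s) (UNIV :: nat set)"
    and sumF: "\<And>v. norm v < \<delta> \<Longrightarrow> ((\<lambda>i. T i (\<lambda>_. v)) has_sum F v) UNIV"
    using F unfolding power_series_le_def by blast
  obtain d' T' c' s' where T': "\<And>i. bounded_multilinear_le (d' i) (c' i) (T' i)"
    and s': "s' \<le> K'" "((\<lambda>i. c' i * \<delta> ^ d' i) has_sum s') (UNIV :: nat set)"
    and sumG: "\<And>v. norm v < \<delta> \<Longrightarrow> ((\<lambda>i. T' i (\<lambda>_. v)) has_sum G v) UNIV"
    using G unfolding power_series_le_def by blast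
  have c0: "0 \<le> c i" "0 \<le> c' i" for i
    by (rule bounded_multilinear_le_nonneg, rule T T')+
  have s0: "0 \<le> s" "0 \<le> s'"
    by (rule has_sum_nonneg[OF s(2)] has_sum_nonneg[OF s'(2)]; use c0 \<open>0 < \<delta>\<close> in auto)+
  have mult: "bounded_multilinear_le (d i + d' j) (c i * c' j) (\<lambda>x. B (T i x) (T' j (\<lambda>l. x (l + d i))))"
    for i j
    unfolding bounded_multilinear_le_def
  proof (intro conjI allI impI)
    have cong: "T i x = T i y" if "\<forall>l<d i. x l = y l" for x y
      using T[of i] that unfolding bounded_multilinear_le_def by blast
    have cong': "T' j x = T' j y" if "\<forall>l<d' j. x l = y l" for x y
      using T'[of j] that unfolding bounded_multilinear_le_def by blast
    show "B (T i x) (T' j (\<lambda>l. x (l + d i))) = B (T i y) (T' j (\<lambda>l. y (l + d i)))"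
      if "\<forall>l<d i + d' j. x l = y l" for x y
      using that by (intro arg_cong2[where f = B] cong cong') auto
    show "linear (\<lambda>v. B (T i (x(l := v))) (T' j (\<lambda>l'. (x(l := v)) (l' + d i))))"
      if "l < d i + d' j" for l x
    proof (cases "l < d i")
      case True
      then have "(\<lambda>l'. (x(l := v)) (l' + d i)) = (\<lambda>l'. x (l' + d i))" for v by auto
      moreover have "linear (\<lambda>v. T i (x(l := v)))"
        using T[of i] True unfolding bounded_multilinear_le_def by blast
      ultimately show ?thesis
        using linear_compose[of "\<lambda>v. T i (x(l := v))" "\<lambda>y. B y (T' j (\<lambda>l'. x (l' + d i)))"]
          bounded_linear_left[THEN bounded_linear.linear] by (simp add: o_def)
    next
      case False
      then have "(\<lambda>l'. (x(l := v)) (l' + d i)) = (\<lambda>l'. x (l' + d i))(l - d i := v)" for v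
        by (auto simp: fun_eq_iff)
      moreover have "T i (x(l := v)) = T i x" for v by (rule cong) (use False in auto)
      moreover have "linear (\<lambda>v. T' j ((\<lambda>l'. x (l' + d i))(l - d i := v)))"
        using T'[of j] False that unfolding bounded_multilinear_le_def by simp
      ultimately show ?thesis
        using linear_compose[of "\<lambda>v. T' j ((\<lambda>l'. x (l' + d i))(l - d i := v))" "B (T i x)"]
          bounded_linear_right[THEN bounded_linear.linear] by (simp add: o_def)
    qed
    show "0 \<le> c i * c' j" using c0 by simp
    show "norm (B (T i x) (T' j (\<lambda>l. x (l + d i)))) \<le> c i * c' j * (\<Prod>l<d i + d' j. norm (x l))" for x
    proof -
      have split: "{..<d i + d' j} = {..<d i} \<union> {d i..<d i + d' j}" by auto
      have shift: "(\<Prod>l = d i..<d i + d' j. norm (x l)) = (\<Prod>l<d' j. norm (x (l + d i)))"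
        by (subst prod.atLeastLessThan_shift_0) (simp add: atLeast0LessThan add.commute)
      have "norm (B (T i x) (T' j (\<lambda>l. x (l + d i)))) \<le> norm (T i x) * norm (T' j (\<lambda>l. x (l + d i)))"
        by (rule B_le)
      also have "\<dots> \<le> (c i * (\<Prod>l<d i. norm (x l))) * (c' j * (\<Prod>l<d' j. norm (x (l + d i))))"
        using T[of i] T'[of j] unfolding bounded_multilinear_le_def
        by (intro mult_mono) (auto intro!: mult_nonneg_nonneg prod_nonneg)
      also have "\<dots> = c i * c' j * (\<Prod>l<d i + d' j. norm (x l))"
        unfolding split by (subst prod.union_disjoint) (auto simp: shift)
      finally show ?thesis .
    qed
  qed
  have row: "power_series_le (\<lambda>v. B (T i (\<lambda>_. v)) (G v)) \<delta> (c i * \<delta> ^ d i * s')" for i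
    unfolding power_series_le_def
  proof (intro exI[of _ "\<lambda>j. d i + d' j"] exI[of _ "\<lambda>j x. B (T i x) (T' j (\<lambda>l. x (l + d i)))"]
      exI[of _ "\<lambda>j. c i * c' j"] conjI allI impI mult exI[of _ "c i * \<delta> ^ d i * s'"] order_refl)
    show "((\<lambda>j. c i * c' j * \<delta> ^ (d i + d' j)) has_sum c i * \<delta> ^ d i * s') UNIV"
      using has_sum_cmult_right[OF s'(2), of "c i * \<delta> ^ d i"] by (simp add: power_add ac_simps)
    show "((\<lambda>j. B (T i (\<lambda>_. v)) (T' j (\<lambda>_. v))) has_sum B (T i (\<lambda>_. v)) (G v)) UNIV"
      if "norm v < \<delta>" for v
      by (rule has_sum_bounded_linear[OF bounded_linear_right sumG[OF that]])
  qed
  have sum_K: "((\<lambda>i. c i * \<delta> ^ d i * s') has_sum s * s') UNIV"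
    by (rule has_sum_cmult_left[OF s(2)])
  have "power_series_le (\<lambda>v. \<Sum>\<^sub>\<infinity>i. B (T i (\<lambda>_. v)) (G v)) \<delta> (s * s')"
    using power_series_le_infsum[OF row has_sum_imp_summable[OF sum_K] \<open>0 < \<delta>\<close>] sum_K
    by (simp add: infsumI)
  moreover have "(\<Sum>\<^sub>\<infinity>i. B (T i (\<lambda>_. v)) (G v)) = B (F v) (G v)" if "norm v < \<delta>" for v
    using has_sum_bounded_linear[OF bounded_linear_left sumF[OF that]] by (rule infsumI)
  moreover have "s * s' \<le> K * K'" using s s' s0 by (intro mult_mono) auto
  ultimately show ?thesis
    by (blast intro: power_series_le_cong power_series_le_mono)
qed

text \<open>
  Collecting the terms of degree \<open>k\<close> gives a \<open>k\<close>-linear map whose bound is the sum of theirs, and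
  these bounds dominate the norms of the homogeneous polynomials.
\<close>

lemma power_series_le_imp_power_series_on_ball:
  fixes F :: "'a::banach \<Rightarrow> 'b::banach"
  assumes F: "power_series_le F \<delta> K" and "0 < \<delta>"
  shows "power_series_on_ball (\<lambda>x. F (x - a)) a \<delta>"
proof -
  obtain d T c s where T: "\<And>i. bounded_multilinear_le (d i) (c i) (T i)"
    and s: "((\<lambda>i. c i * \<delta> ^ d i) has_sum s) (UNIV :: nat set)"
    and sumF: "\<And>v. norm v < \<delta> \<Longrightarrow> ((\<lambda>i. T i (\<lambda>_. v)) has_sum F v) UNIV"
    using F unfolding power_series_le_def by blast
  define I where "I k = {i. d i = k}" for k
  have c0: "0 \<le> c i" for i
    by (rule bounded_multilinear_le_nonneg[OF T])
  have c_summable: "c summable_on I k" for k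
  proof -
    have "(\<lambda>i. c i * \<delta> ^ d i) summable_on I k"
      using has_sum_imp_summable[OF s] by (rule summable_on_subset) auto
    then have "(\<lambda>i. c i * \<delta> ^ k) summable_on I k"
      by (rule summable_on_cong[THEN iffD1, rotated]) (auto simp: I_def)
    from summable_on_cmult_left[OF this, of "inverse (\<delta> ^ k)"] show ?thesis
      using \<open>0 < \<delta>\<close> by (simp add: mult.assoc)
  qed
  have T_le: "norm (T i x) \<le> c i * (\<Prod>l<k. norm (x l))" if "i \<in> I k" for i k x
    using T[of i] that unfolding bounded_multilinear_le_def I_def by auto
  have T_abs: "(\<lambda>i. T i x) abs_summable_on I k" for x k
    by (rule Infinite_Sum.abs_summable_on_comparison_test'[where g = "\<lambda>i. c i * (\<Prod>l<k. norm (x l))"])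
       (use summable_on_cmult_left[OF c_summable] T_le in auto)
  have T_summable: "(\<lambda>i. T i x) summable_on I k" for x k
    by (rule abs_summable_summable[OF T_abs])
  define A where "A k x = (\<Sum>\<^sub>\<infinity>i\<in>I k. T i x)" for k x
  define C where "C k = (\<Sum>\<^sub>\<infinity>i\<in>I k. c i)" for k
  have A_le: "norm (A k x) \<le> C k * (\<Prod>l<k. norm (x l))" for k x
    unfolding A_def C_def
    by (rule norm_infsum_le[OF has_sum_infsum[OF T_summable]
          has_sum_cmult_left[OF has_sum_infsum[OF c_summable]] T_le])
  have multi: "bounded_multilinear k (A k)" for k
    unfolding bounded_multilinear_def
  proof (intro conjI allI impI)
    show "A k x = A k y" if "\<forall>i<k. x i = y i" for x y
      unfolding A_def using T that
      by (intro infsum_cong) (auto simp: I_def bounded_multilinear_le_def)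
    show "linear (\<lambda>v. A k (x(l := v)))" if "l < k" for l x
    proof -
      have lin: "linear (\<lambda>v. T i (x(l := v)))" if "i \<in> I k" for i
        using T[of i] that \<open>l < k\<close> unfolding bounded_multilinear_le_def I_def by blast
      show ?thesis
      proof (rule linearI)
        show "A k (x(l := v + w)) = A k (x(l := v)) + A k (x(l := w))" for v w
          unfolding A_def
          by (subst infsum_add[OF T_summable T_summable, symmetric])
             (auto intro!: infsum_cong dest: linear_add[OF lin])
        show "A k (x(l := r *\<^sub>R v)) = r *\<^sub>R A k (x(l := v))" for r v
          unfolding A_def
          by (subst infsum_scaleR_right[symmetric])
             (auto intro!: infsum_cong dest: linear_scale[OF lin])
      qed
    qed
    show "\<exists>K. \<forall>x. norm (A k x) \<le> K * (\<Prod>i<k. norm (x i))"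
      using A_le by blast
  qed
  define P where "P k v = A k (\<lambda>_. v)" for k v
  have bij: "bij_betw snd (SIGMA k:UNIV. I k) UNIV"
    by (rule bij_betwI[where g = "\<lambda>i. (d i, i)"]) (auto simp: I_def)
  have P_le: "norm (P k v) \<le> C k * norm v ^ k" for k v
    using A_le[of k "\<lambda>_. v"] by (simp add: P_def)
  have C0: "0 \<le> C k" for k unfolding C_def by (rule infsum_nonneg) (rule c0)
  have "(\<lambda>k. C k * \<delta> ^ k) summable_on UNIV"
  proof -
    have sg: "((\<lambda>p. c (snd p) * \<delta> ^ d (snd p)) has_sum s) (SIGMA k:UNIV. I k)"
      using has_sum_reindex_bij_betw[OF bij, THEN iffD2, OF s] by simp
    have "((\<lambda>i. c (snd (k, i)) * \<delta> ^ d (snd (k, i))) has_sum C k * \<delta> ^ k) (I k)" for k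
    proof -
      have "((\<lambda>i. c i * \<delta> ^ k) has_sum C k * \<delta> ^ k) (I k)"
        unfolding C_def by (rule has_sum_cmult_left[OF has_sum_infsum[OF c_summable]])
      also have "?this \<longleftrightarrow> ?thesis"
        by (rule has_sum_cong) (auto simp: I_def)
      finally show ?thesis .
    qed
    from has_sum_SigmaD[OF sg this] show ?thesis by (rule has_sum_imp_summable)
  qed
  then have C_summable: "summable (\<lambda>k. C k * \<delta> ^ k)"
    by (rule summable_on_imp_summable)
  have poly_norm_le: "0 \<le> poly_norm (P k) \<and> poly_norm (P k) \<le> C k" for k
  proof -
    have le: "norm (P k v) \<le> C k" if "v \<in> cball 0 1" for v
      using P_le[of k v] mult_left_mono[OF power_le_one[of "norm v" k] C0[of k]] that by simp
    have "norm (P k 0) \<le> poly_norm (P k)"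
      unfolding poly_norm_def by (rule cSUP_upper) (auto intro!: bdd_aboveI2 le)
    moreover have "poly_norm (P k) \<le> C k"
      unfolding poly_norm_def by (rule cSUP_least) (auto intro!: le)
    ultimately show ?thesis using norm_ge_zero order_trans by blast
  qed
  show ?thesis
    unfolding power_series_on_ball_def
  proof (intro exI[of _ P] conjI allI ballI)
    show "bounded_homogeneous_poly k (P k)" for k
      unfolding bounded_homogeneous_poly_def using multi P_def by blast
    show "summable (\<lambda>k. poly_norm (P k) * \<delta> ^ k)"
      by (rule summable_comparison_test'[OF C_summable, of 0])
         (use poly_norm_le \<open>0 < \<delta>\<close> in \<open>auto simp: abs_mult intro!: mult_right_mono\<close>)
    show "(\<lambda>k. P k (x - a)) sums F (x - a)" if "x \<in> ball a \<delta>" for x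
    proof -
      have "norm (x - a) < \<delta>" using that by (simp add: dist_norm norm_minus_commute)
      from has_sum_reindex_bij_betw[OF bij, THEN iffD2, OF sumF[OF this]]
      have sg: "((\<lambda>p. T (snd p) (\<lambda>_. x - a)) has_sum F (x - a)) (SIGMA k:UNIV. I k)" by simp
      have "((\<lambda>i. T (snd (k, i)) (\<lambda>_. x - a)) has_sum P k (x - a)) (I k)" for k
        using has_sum_infsum[OF T_summable, of "\<lambda>_. x - a" k] by (simp add: P_def A_def)
      from has_sum_SigmaD[OF sg this] show ?thesis by (rule has_sum_imp_sums)
    qed
  qed
qed

lemma power_series_le_scaleR:
  fixes F :: "'a::banach \<Rightarrow> 'b::banach"
  assumes "power_series_le F \<delta> K" and "0 < \<delta>"
  shows "power_series_le (\<lambda>v. c *\<^sub>R F v) \<delta> (\<bar>c\<bar> * K)"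
  using power_series_le_bilinear[OF power_series_le_const assms bounded_bilinear_scaleR, of c]
  by simp

text \<open>
  A linear map becomes bilinear by letting a real scalar multiply its values, so this is the bilinear
  rule with the constant series \<open>1\<close>.
\<close>

lemma power_series_le_compose_linear:
  fixes F :: "'a::banach \<Rightarrow> 'b::banach" and T :: "'b \<Rightarrow> 'c::banach"
  assumes "power_series_le F \<delta> K" and "0 < \<delta>"
    and "linear T" and le: "\<And>y. norm (T y) \<le> norm y"
  shows "power_series_le (\<lambda>v. T (F v)) \<delta> K"
proof -
  have "bounded_linear T"
    using assms(3) le by (intro bounded_linear_intro[where K = 1]) (auto simp: linear_add linear_scale)
  then have "bounded_bilinear (\<lambda>c y. c *\<^sub>R T y)"
    by (rule bounded_bilinear.comp[OF bounded_bilinear_scaleR bounded_linear_ident])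
  from power_series_le_bilinear[OF power_series_le_const assms(1,2) this, of 1] show ?thesis
    using le by (simp add: mult_left_mono)
qed

section \<open>Coordinatewise operations on square-summable families\<close>

lemma ell2_nth_summable: "(\<lambda>i. (ell2_nth x i)\<^sup>2) summable_on UNIV"
  using ell2_nth[of x] by simp

lemma ell2_norm_square: "((\<lambda>i. (ell2_nth x i)\<^sup>2) has_sum (norm x)\<^sup>2) UNIV"
  using has_sum_infsum[OF ell2_nth_summable[of x]]
  by (simp add: norm_ell2.rep_eq infsum_nonneg)

lemma ell2_eqI: "(\<And>i. ell2_nth x i = ell2_nth y i) \<Longrightarrow> x = y"
  by (simp add: ell2_nth_inject[symmetric] fun_eq_iff)

lemma ell2_inner_has_sum:
  "((\<lambda>i. ell2_nth x i * ell2_nth y i) has_sum inner x y) UNIV"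
  using has_sum_infsum[OF sq_summable_mult[OF ell2_nth_summable ell2_nth_summable], of x y]
  by (simp add: inner_ell2.rep_eq)

lemma bounded_linear_ell2_nth: "bounded_linear (\<lambda>x. ell2_nth x i)"
  by (rule bounded_linear_intro[where K = 1])
     (use ell2_nth_le_norm[of _ i] in \<open>auto simp: plus_ell2.rep_eq scaleR_ell2.rep_eq\<close>)

text \<open>
  The representation function returns an unspecified element outside the square-summable families, so
  each bound below is proved together with the fact that the family is represented by its own values.
\<close>

lemma ell2_normI:
  assumes "(\<lambda>i. (x i)\<^sup>2) summable_on UNIV" and "(\<Sum>\<^sub>\<infinity>i. (x i)\<^sup>2) \<le> C\<^sup>2" and "0 \<le> C"
  shows "ell2_nth (Abs_ell2 x) = x" and "norm (Abs_ell2 x) \<le> C"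
proof -
  show nth: "ell2_nth (Abs_ell2 x) = x"
    using assms(1) by (simp add: Abs_ell2_inverse)
  show "norm (Abs_ell2 x) \<le> C"
    using assms(2,3) by (simp add: norm_ell2.rep_eq nth real_le_lsqrt)
qed

lemma ell2_finite_boundI:
  assumes le: "\<And>F. finite F \<Longrightarrow> (\<Sum>i\<in>F. (x i)\<^sup>2) \<le> C\<^sup>2" and "0 \<le> C"
  shows "ell2_nth (Abs_ell2 x) = x" and "norm (Abs_ell2 x) \<le> C"
proof -
  have s: "(\<lambda>i. (x i)\<^sup>2) summable_on UNIV"
    by (rule nonneg_bdd_above_summable_on) (auto intro!: bdd_aboveI2[where M = "C\<^sup>2"] le)
  have "(\<Sum>\<^sub>\<infinity>i. (x i)\<^sup>2) \<le> C\<^sup>2"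
    by (rule infsum_le_finite_sums[OF s]) (auto intro: le)
  from ell2_normI[OF s this \<open>0 \<le> C\<close>]
  show "ell2_nth (Abs_ell2 x) = x" and "norm (Abs_ell2 x) \<le> C" .
qed

lemma ell2_dominatedI:
  assumes "\<And>i. \<bar>x i\<bar> \<le> C * \<bar>ell2_nth y i\<bar>" and "0 \<le> C"
  shows "ell2_nth (Abs_ell2 x) = x" and "norm (Abs_ell2 x) \<le> C * norm y"
proof -
  have le: "(x i)\<^sup>2 \<le> C\<^sup>2 * (ell2_nth y i)\<^sup>2" for i
    using power_mono[OF assms(1), of i 2] by (simp add: power_mult_distrib)
  have *: "(\<Sum>i\<in>F. (x i)\<^sup>2) \<le> (C * norm y)\<^sup>2" if "finite F" for F
  proof -
    have "(\<Sum>i\<in>F. (x i)\<^sup>2) \<le> C\<^sup>2 * (\<Sum>i\<in>F. (ell2_nth y i)\<^sup>2)"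
      unfolding sum_distrib_left by (rule sum_mono[OF le])
    also have "\<dots> \<le> C\<^sup>2 * (norm y)\<^sup>2"
      by (intro mult_left_mono ell2_finite_sum_le_norm that) auto
    finally show ?thesis by (simp add: power_mult_distrib)
  qed
  show "ell2_nth (Abs_ell2 x) = x" and "norm (Abs_ell2 x) \<le> C * norm y"
    using ell2_finite_boundI[of x, OF *] assms(2) by auto
qed

definition ell2_mult :: "'i ell2 \<Rightarrow> 'i ell2 \<Rightarrow> 'i ell2" where
  "ell2_mult x y = Abs_ell2 (\<lambda>i. ell2_nth x i * ell2_nth y i)"

lemma ell2_mult_nth: "ell2_nth (ell2_mult x y) i = ell2_nth x i * ell2_nth y i"
  and ell2_mult_norm: "norm (ell2_mult x y) \<le> norm x * norm y"
proof -
  have le: "\<bar>ell2_nth x i * ell2_nth y i\<bar> \<le> norm x * \<bar>ell2_nth y i\<bar>" for i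
    using ell2_nth_le_norm[of x i] by (simp add: abs_mult mult_right_mono)
  show "ell2_nth (ell2_mult x y) i = ell2_nth x i * ell2_nth y i"
    and "norm (ell2_mult x y) \<le> norm x * norm y"
    unfolding ell2_mult_def using ell2_dominatedI[of _ "norm x" y, OF le] by auto
qed

lemma bounded_bilinear_ell2_mult: "bounded_bilinear ell2_mult"
proof
  show "\<exists>K. \<forall>a b. norm (ell2_mult a b) \<le> norm a * norm b * K"
    by (rule exI[of _ 1]) (simp add: ell2_mult_norm)
qed (auto intro!: ell2_eqI simp: ell2_mult_nth plus_ell2.rep_eq scaleR_ell2.rep_eq algebra_simps)

definition ell2_row :: "('i \<times> 'k) ell2 \<Rightarrow> 'i \<Rightarrow> 'k ell2" where
  "ell2_row X i = Abs_ell2 (\<lambda>k. ell2_nth X (i, k))"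

lemma ell2_row_nth: "ell2_nth (ell2_row X i) k = ell2_nth X (i, k)"
  and ell2_rows_norm: "((\<lambda>i. (norm (ell2_row X i))\<^sup>2) has_sum (norm X)\<^sup>2) UNIV"
proof -
  have X: "((\<lambda>p. (ell2_nth X p)\<^sup>2) has_sum (norm X)\<^sup>2) (UNIV \<times> UNIV)"
    using ell2_norm_square[of X] by simp
  have s: "(\<lambda>k. (ell2_nth X (i, k))\<^sup>2) summable_on UNIV" for i
    using summable_on_SigmaD1[of "\<lambda>i k. (ell2_nth X (i, k))\<^sup>2" UNIV "\<lambda>_. UNIV" i]
      has_sum_imp_summable[OF X] by (simp add: case_prod_unfold)
  have nth: "ell2_nth (ell2_row X i) k = ell2_nth X (i, k)" for i k
    unfolding ell2_row_def using s by (subst Abs_ell2_inverse) auto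
  then show "ell2_nth (ell2_row X i) k = ell2_nth X (i, k)" .
  show "((\<lambda>i. (norm (ell2_row X i))\<^sup>2) has_sum (norm X)\<^sup>2) UNIV"
    by (rule has_sum_SigmaD[OF X]) (use ell2_norm_square[of "ell2_row X _"] in \<open>simp add: nth\<close>)
qed

text \<open>
  The sum over the second index of the entrywise product of two matrices. It turns quadratic expressions
  in a square-summable matrix into sequences that are again square-summable.
\<close>

definition ell2_row_inner :: "('i \<times> 'k) ell2 \<Rightarrow> ('i \<times> 'k) ell2 \<Rightarrow> 'i ell2" where
  "ell2_row_inner X Y = Abs_ell2 (\<lambda>i. inner (ell2_row X i) (ell2_row Y i))"

text \<open>
  By Cauchy--Schwarz the entry at \<open>i\<close> is at most the product of the norms of the two \<open>i\<close>-th rows; the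
  squared row norms of \<open>X\<close> add up to \<open>\<parallel>X\<parallel>\<^sup>2\<close> and the row norms of \<open>Y\<close> are bounded by \<open>\<parallel>Y\<parallel>\<close>.
\<close>

lemma ell2_row_inner_nth_inner: "ell2_nth (ell2_row_inner X Y) i = inner (ell2_row X i) (ell2_row Y i)"
  and ell2_row_inner_norm: "norm (ell2_row_inner X Y) \<le> norm X * norm Y"
proof -
  have row_le: "(norm (ell2_row Y i))\<^sup>2 \<le> (norm Y)\<^sup>2" for i
    using finite_sum_le_has_sum[OF ell2_rows_norm[of Y], of "{i}"] by simp
  have "(\<Sum>i\<in>F. (inner (ell2_row X i) (ell2_row Y i))\<^sup>2) \<le> (norm X * norm Y)\<^sup>2" if "finite F" for F
  proof -
    have "(inner (ell2_row X i) (ell2_row Y i))\<^sup>2 \<le> (norm (ell2_row X i))\<^sup>2 * (norm Y)\<^sup>2" for i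
    proof -
      have "(inner (ell2_row X i) (ell2_row Y i))\<^sup>2 \<le> (norm (ell2_row X i) * norm (ell2_row Y i))\<^sup>2"
        using power_mono[OF Cauchy_Schwarz_ineq2 abs_ge_zero, of "ell2_row X i" "ell2_row Y i" 2] by simp
      also have "\<dots> \<le> (norm (ell2_row X i))\<^sup>2 * (norm Y)\<^sup>2"
        unfolding power_mult_distrib by (intro mult_left_mono row_le) auto
      finally show ?thesis .
    qed
    then have "(\<Sum>i\<in>F. (inner (ell2_row X i) (ell2_row Y i))\<^sup>2)
        \<le> (\<Sum>i\<in>F. (norm (ell2_row X i))\<^sup>2) * (norm Y)\<^sup>2"
      unfolding sum_distrib_right by (rule sum_mono)
    also have "\<dots> \<le> (norm X)\<^sup>2 * (norm Y)\<^sup>2"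
      by (intro mult_right_mono finite_sum_le_has_sum[OF ell2_rows_norm] that) auto
    finally show ?thesis by (simp add: power_mult_distrib)
  qed
  from ell2_finite_boundI[of _ "norm X * norm Y", OF this]
  show "ell2_nth (ell2_row_inner X Y) i = inner (ell2_row X i) (ell2_row Y i)"
    and "norm (ell2_row_inner X Y) \<le> norm X * norm Y"
    by (simp_all add: ell2_row_inner_def)
qed

lemma ell2_row_inner_nth:
  "((\<lambda>k. ell2_nth X (i, k) * ell2_nth Y (i, k)) has_sum ell2_nth (ell2_row_inner X Y) i) UNIV"
  using ell2_inner_has_sum[of "ell2_row X i" "ell2_row Y i"]
  by (simp add: ell2_row_nth ell2_row_inner_nth_inner)

lemma bounded_bilinear_ell2_row_inner: "bounded_bilinear ell2_row_inner"
proof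
  have row_add: "ell2_row (X + Y) i = ell2_row X i + ell2_row Y i" for X Y :: "('a \<times> 'b) ell2" and i
    by (rule ell2_eqI) (simp add: ell2_row_nth plus_ell2.rep_eq)
  have row_scale: "ell2_row (r *\<^sub>R X) i = r *\<^sub>R ell2_row X i" for X :: "('a \<times> 'b) ell2" and r i
    by (rule ell2_eqI) (simp add: ell2_row_nth scaleR_ell2.rep_eq)
  fix X X' Y Y' :: "('a \<times> 'b) ell2" and r :: real
  show "ell2_row_inner (X + X') Y = ell2_row_inner X Y + ell2_row_inner X' Y"
    and "ell2_row_inner X (Y + Y') = ell2_row_inner X Y + ell2_row_inner X Y'"
    and "ell2_row_inner (r *\<^sub>R X) Y = r *\<^sub>R ell2_row_inner X Y"
    and "ell2_row_inner X (r *\<^sub>R Y) = r *\<^sub>R ell2_row_inner X Y"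
    by (auto intro!: ell2_eqI simp: ell2_row_inner_nth_inner plus_ell2.rep_eq scaleR_ell2.rep_eq
        row_add row_scale inner_add_left inner_add_right)
  show "\<exists>K. \<forall>(a :: ('a \<times> 'b) ell2) b. norm (ell2_row_inner a b) \<le> norm a * norm b * K"
    by (rule exI[of _ 1]) (simp add: ell2_row_inner_norm)
qed

text \<open>
  Exponents are shifted by one, because a constant family different from \<open>0\<close> over an infinite index
  set is not square-summable: entries are raised to the power \<open>m + 1\<close>.
\<close>

primrec ell2_power :: "'i ell2 \<Rightarrow> nat \<Rightarrow> 'i ell2" where
  "ell2_power y 0 = y"
| "ell2_power y (Suc m) = ell2_mult y (ell2_power y m)"

lemma ell2_power_nth: "ell2_nth (ell2_power y m) i = ell2_nth y i ^ Suc m"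
  by (induction m) (simp_all add: ell2_mult_nth)

lemma ell2_power_norm: "norm (ell2_power y m) \<le> norm y ^ Suc m"
proof (induction m)
  case (Suc m)
  from mult_left_mono[OF this norm_ge_zero[of y]] show ?case
    using ell2_mult_norm[of y "ell2_power y m"] by simp
qed simp

text \<open>
  The scalar power series \<open>\<Sum>m. c m t\<^sup>m\<^sup>+\<^sup>1\<close>, without constant term, applied to every coordinate.
\<close>

definition ell2_coordinate_series :: "(nat \<Rightarrow> real) \<Rightarrow> 'i ell2 \<Rightarrow> 'i ell2" where
  "ell2_coordinate_series c y = (\<Sum>\<^sub>\<infinity>m. c m *\<^sub>R ell2_power y m)"

lemma ell2_coordinate_series_nth:
  assumes c: "(\<lambda>m. \<bar>c m\<bar> * K ^ Suc m) summable_on UNIV" and "norm y \<le> K"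
  shows "((\<lambda>m. c m * ell2_nth y i ^ Suc m) has_sum ell2_nth (ell2_coordinate_series c y) i) UNIV"
proof -
  have "(\<lambda>m. c m *\<^sub>R ell2_power y m) abs_summable_on UNIV"
  proof (rule Infinite_Sum.abs_summable_on_comparison_test'[OF c])
    fix m
    have "norm (ell2_power y m) \<le> K ^ Suc m"
      by (rule order_trans[OF ell2_power_norm power_mono]) (use assms in auto)
    then show "norm (c m *\<^sub>R ell2_power y m) \<le> \<bar>c m\<bar> * K ^ Suc m"
      by (simp only: norm_scaleR mult_left_mono abs_ge_zero)
  qed
  then have "((\<lambda>m. c m *\<^sub>R ell2_power y m) has_sum ell2_coordinate_series c y) UNIV"
    unfolding ell2_coordinate_series_def by (rule has_sum_infsum[OF abs_summable_summable])
  from has_sum_bounded_linear[OF bounded_linear_ell2_nth this, of i] show ?thesis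
    by (simp only: scaleR_ell2.rep_eq ell2_power_nth)
qed

lemma power_series_le_coordinate_series:
  fixes Y :: "'a::banach \<Rightarrow> 'i ell2"
  assumes Y: "power_series_le Y \<delta> K" and "0 < \<delta>" and c: "(\<lambda>m. \<bar>c m\<bar> * K ^ Suc m) summable_on UNIV"
  shows "\<exists>L. power_series_le (\<lambda>v. ell2_coordinate_series c (Y v)) \<delta> L"
proof -
  have pow: "power_series_le (\<lambda>v. ell2_power (Y v) m) \<delta> (K ^ Suc m)" for m
  proof (induction m)
    case (Suc m)
    from power_series_le_bilinear[OF Y Suc \<open>0 < \<delta>\<close> bounded_bilinear_ell2_mult ell2_mult_norm]
    show ?case by simp
  qed (simp add: Y)
  show ?thesis
    unfolding ell2_coordinate_series_def
    by (rule exI, rule power_series_le_infsum[OF power_series_le_scaleR[OF pow \<open>0 < \<delta>\<close>] c \<open>0 < \<delta>\<close>])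
qed

definition ell2_reindex :: "('j \<Rightarrow> 'i) \<Rightarrow> 'i ell2 \<Rightarrow> 'j ell2" where
  "ell2_reindex g x = Abs_ell2 (\<lambda>j. ell2_nth x (g j))"

lemma ell2_reindex_nth: "inj g \<Longrightarrow> ell2_nth (ell2_reindex g x) j = ell2_nth x (g j)"
  and ell2_reindex_norm: "inj g \<Longrightarrow> norm (ell2_reindex g x) \<le> norm x"
proof -
  assume "inj g"
  have "(\<Sum>j\<in>F. (ell2_nth x (g j))\<^sup>2) \<le> (norm x)\<^sup>2" if "finite F" for F
    using ell2_finite_sum_le_norm[of "g ` F" x] that \<open>inj g\<close>
    by (simp add: sum.reindex inj_on_subset)
  from ell2_finite_boundI[of _ "norm x", OF this]
  show "ell2_nth (ell2_reindex g x) j = ell2_nth x (g j)"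
    and "norm (ell2_reindex g x) \<le> norm x" by (simp_all add: ell2_reindex_def)
qed

lemma linear_ell2_reindex: "inj g \<Longrightarrow> linear (ell2_reindex g)"
  by (auto intro!: linearI ell2_eqI simp: ell2_reindex_nth plus_ell2.rep_eq scaleR_ell2.rep_eq)

section \<open>The discrete Hilbert transform\<close>

text \<open>
  The convention \<open>inverse 0 = 0\<close> makes \<open>recip (k - j)\<close> vanish on the diagonal, so that sums over
  \<open>k \<noteq> j\<close> are sums over all \<open>k\<close>.
\<close>

abbreviation recip :: "int \<Rightarrow> real" where
  "recip k \<equiv> inverse (of_int k)"

text \<open>
  The interleaved indices \<open>2 m\<close> and \<open>2 m + 1\<close> with \<open>- N \<le> m \<le> N\<close>.
\<close>

abbreviation window :: "nat \<Rightarrow> int set" where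
  "window N \<equiv> {- (2 * int N)..2 * int N + 1}"

lemma summable_recip_square: "(\<lambda>k. (recip k)\<^sup>2) summable_on UNIV"
proof -
  have nat: "(\<lambda>n. (recip (int n))\<^sup>2) summable_on UNIV"
    by (rule norm_summable_imp_summable_on)
       (use inverse_power_summable[of 2, where 'a = real] in \<open>simp add: power_inverse\<close>)
  have "(\<lambda>k. (recip k)\<^sup>2) summable_on range int"
    by (subst summable_on_reindex) (use nat in \<open>simp_all add: o_def\<close>)
  moreover have "(\<lambda>k. (recip k)\<^sup>2) summable_on range (\<lambda>n. - int n)"
    by (subst summable_on_reindex) (use nat in \<open>simp_all add: o_def inj_on_def\<close>)
  moreover have "range int \<union> range (\<lambda>n. - int n) = UNIV"
  proof -
    have "k \<in> range int \<union> range (\<lambda>n. - int n)" for k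
      by (cases k rule: int_cases2) auto
    then show ?thesis by blast
  qed
  ultimately show ?thesis
    using summable_on_union by metis
qed

definition recip_square_sum :: real where
  "recip_square_sum = (\<Sum>\<^sub>\<infinity>k. (recip k)\<^sup>2)"

lemma bij_int_diff: "bij_betw (\<lambda>k. k - j) UNIV (UNIV :: int set)" "bij_betw (\<lambda>k. j - k) UNIV (UNIV :: int set)"
  by (rule bij_betwI[where g = "\<lambda>k. k + j"]; simp) (rule bij_betwI[where g = "\<lambda>k. j - k"]; simp)

lemma recip_square_has_sum:
  "((\<lambda>k. (recip (k - j))\<^sup>2) has_sum recip_square_sum) UNIV"
  "((\<lambda>k. (recip (j - k))\<^sup>2) has_sum recip_square_sum) UNIV"
  using has_sum_reindex_bij_betw[OF bij_int_diff(1)[of j], of "\<lambda>k. (recip k)\<^sup>2" recip_square_sum]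
    has_sum_reindex_bij_betw[OF bij_int_diff(2)[of j], of "\<lambda>k. (recip k)\<^sup>2" recip_square_sum]
    has_sum_infsum[OF summable_recip_square] by (simp_all add: recip_square_sum_def)

lemma recip_square_sum_nonneg: "0 \<le> recip_square_sum"
  unfolding recip_square_sum_def by (rule infsum_nonneg) simp

lemma filterlim_window: "filterlim window (finite_subsets_at_top UNIV) sequentially"
  unfolding filterlim_finite_subsets_at_top
proof (intro allI impI)
  fix X :: "int set" assume "finite X \<and> X \<subseteq> UNIV"
  then have "\<forall>\<^sub>F N in sequentially. \<forall>k\<in>X. k \<in> window N"
  proof (intro eventually_ball_finite ballI)
    show "\<forall>\<^sub>F N in sequentially. k \<in> window N" for k
      by (rule eventually_sequentiallyI[of "nat \<bar>k\<bar>"]) auto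
  qed auto
  then show "\<forall>\<^sub>F N in sequentially. finite (window N) \<and> X \<subseteq> window N \<and> window N \<subseteq> UNIV"
    by eventually_elim auto
qed

lemma has_sum_imp_window_limit:
  assumes "(f has_sum s) UNIV"
  shows "(\<lambda>N. \<Sum>k\<in>window N. f k) \<longlonglongrightarrow> s"
  using filterlim_compose[OF _ filterlim_window, of "sum f" "nhds s"] assms
  by (simp add: has_sum_def)

lemma sum_int_interval_shift:
  fixes g :: "int \<Rightarrow> real"
  assumes "a \<le> b"
  shows "(\<Sum>k\<in>{a..b}. g (k - 1)) = (\<Sum>k\<in>{a..b}. g k) + g (a - 1) - g b"
proof -
  have "(\<Sum>k\<in>{a..b}. g (k - 1)) = sum g {a - 1..b - 1}"
    by (rule sum.reindex_bij_witness[of _ "\<lambda>k. k + 1" "\<lambda>k. k - 1"]) auto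
  moreover have "insert b {a - 1..b - 1} = insert (a - 1) {a..b}" using assms by auto
  then have "sum g (insert b {a - 1..b - 1}) = sum g (insert (a - 1) {a..b})" by simp
  ultimately show ?thesis by simp
qed

lemma tendsto_recip_affine:
  assumes "c \<noteq> 0"
  shows "(\<lambda>N. recip (c * int N + d)) \<longlonglongrightarrow> 0"
proof -
  have "(\<lambda>N. inverse (of_int c * real N + of_int d)) \<longlonglongrightarrow> 0"
    using assms by real_asymp
  then show ?thesis by simp
qed

text \<open>
  For \<open>j = 0\<close> the terms cancel in pairs up to the last one. Moving the centre by one step exchanges
  two end terms, which tend to \<open>0\<close>.
\<close>

lemma recip_window_sum_tendsto_zero: "(\<lambda>N. \<Sum>k\<in>window N. recip (k - j)) \<longlonglongrightarrow> 0"
proof -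
  define s where "s j N = (\<Sum>k\<in>window N. recip (k - j))" for j N
  define e where "e j N = recip ((- 2) * int N + (- 1 - j)) - recip (2 * int N + (1 - j))" for j N
  have step: "s (j + 1) = (\<lambda>N. s j N + e j N)" for j
  proof
    show "s (j + 1) N = s j N + e j N" for N
      using sum_int_interval_shift[of "- (2 * int N)" "2 * int N + 1" "\<lambda>k. recip (k - j)"]
      by (simp add: s_def e_def algebra_simps)
  qed
  have lim: "e j \<longlonglongrightarrow> 0" for j
    using tendsto_diff[OF tendsto_recip_affine[of "- 2" "- 1 - j"] tendsto_recip_affine[of 2 "1 - j"]]
    by (simp add: e_def[abs_def] del: of_int_add of_int_mult)
  have "s j \<longlonglongrightarrow> 0"
  proof (induction j rule: int_induct[of _ 0])
    case base
    have "s 0 N = recip (2 * int N + 1)" for N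
    proof -
      have "window N = insert (2 * int N + 1) {- (2 * int N)..2 * int N}" by auto
      moreover have "(\<Sum>k\<in>{- (2 * int N)..2 * int N}. recip k) = (\<Sum>k\<in>{- (2 * int N)..2 * int N}. - recip k)"
        by (rule sum.reindex_bij_witness[of _ uminus uminus]) auto
      ultimately show ?thesis by (simp add: s_def sum_negf)
    qed
    then have "s 0 = (\<lambda>N. recip (2 * int N + 1))" by blast
    then show ?case using tendsto_recip_affine[of 2 1] by simp
  next
    case (step1 i)
    from tendsto_add[OF step1(2) lim[of i]] show ?case by (simp add: step)
  next
    case (step2 i)
    have "s (i - 1) = (\<lambda>N. s i N - e (i - 1) N)"
      using step[of "i - 1"] by simp
    with tendsto_diff[OF step2(2) lim[of "i - 1"]] show ?case by simp
  qed
  then show ?thesis by (simp add: s_def[abs_def])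
qed

text \<open>
  The \<open>j\<close>-th row of the matrix of the discrete Hilbert transform.
\<close>

definition hilbert_kernel :: "int \<Rightarrow> int ell2" where
  "hilbert_kernel j = Abs_ell2 (\<lambda>k. recip (k - j))"

lemma hilbert_kernel_nth: "ell2_nth (hilbert_kernel j) k = recip (k - j)"
  unfolding hilbert_kernel_def
  using has_sum_imp_summable[OF recip_square_has_sum(1)[of j]] by (subst Abs_ell2_inverse) auto

lemma hilbert_kernel_norm: "inner (hilbert_kernel j) (hilbert_kernel j) = recip_square_sum"
  using ell2_inner_has_sum[of "hilbert_kernel j" "hilbert_kernel j"] recip_square_has_sum(1)[of j]
  by (intro has_sum_unique) (simp_all add: hilbert_kernel_nth power2_eq_square)

text \<open>
  Partial fractions write \<open>1 / ((k - j) (k - l))\<close> as a multiple of \<open>1 / (k - j) - 1 / (k - l)\<close>, whose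
  symmetric sums tend to \<open>0\<close>. The value comes from the two indices \<open>k = j\<close> and \<open>k = l\<close>, where the
  partial fractions identity fails by \<open>(recip (j - l))\<^sup>2\<close>.
\<close>

lemma hilbert_kernel_inner:
  assumes "j \<noteq> l"
  shows "inner (hilbert_kernel j) (hilbert_kernel l) = 2 * (recip (j - l))\<^sup>2"
proof -
  let ?r = "recip (j - l)"
  let ?s = "\<lambda>N. ?r * ((\<Sum>k\<in>window N. recip (k - j)) - (\<Sum>k\<in>window N. recip (k - l))) + 2 * ?r\<^sup>2"
  \<comment> \<open>The two indicator terms repair the identity at the poles, where \<open>inverse 0 = 0\<close> is used.\<close>
  have pointwise: "recip (k - j) * recip (k - l) =
      ?r * (recip (k - j) - recip (k - l)) + ((if k = j then ?r\<^sup>2 else 0) + (if k = l then ?r\<^sup>2 else 0))"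
    for k
  proof (cases "k = j \<or> k = l")
    case True
    moreover have "inverse (real_of_int l - real_of_int j) = - ?r"
      by (metis inverse_minus_eq minus_diff_eq of_int_diff)
    ultimately show ?thesis using assms
      by (auto simp: power2_eq_square)
  next
    case False
    then have "real_of_int (k - j) \<noteq> 0" "real_of_int (k - l) \<noteq> 0" "real_of_int (j - l) \<noteq> 0"
      using assms by auto
    then show ?thesis using False
      by (simp add: divide_simps)
  qed
  have ev: "\<forall>\<^sub>F N in sequentially. (\<Sum>k\<in>window N. recip (k - j) * recip (k - l)) = ?s N"
  proof (rule eventually_sequentiallyI[of "nat (max \<bar>j\<bar> \<bar>l\<bar>)"])
    fix N assume "nat (max \<bar>j\<bar> \<bar>l\<bar>) \<le> N"
    then have "j \<in> window N" "l \<in> window N" by auto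
    then show "(\<Sum>k\<in>window N. recip (k - j) * recip (k - l)) = ?s N"
      unfolding pointwise sum.distrib sum_distrib_left[symmetric] sum_subtractf
      by (simp add: sum.delta)
  qed
  have "?s \<longlonglongrightarrow> ?r * (0 - 0) + 2 * ?r\<^sup>2"
    by (intro tendsto_intros recip_window_sum_tendsto_zero)
  then have "(\<lambda>N. \<Sum>k\<in>window N. recip (k - j) * recip (k - l)) \<longlonglongrightarrow> 2 * ?r\<^sup>2"
    using tendsto_cong[OF ev] by simp
  moreover have "(\<lambda>N. \<Sum>k\<in>window N. recip (k - j) * recip (k - l))
      \<longlonglongrightarrow> inner (hilbert_kernel j) (hilbert_kernel l)"
    using has_sum_imp_window_limit[OF ell2_inner_has_sum[of "hilbert_kernel j" "hilbert_kernel l"]]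
    by (simp add: hilbert_kernel_nth)
  ultimately show ?thesis using LIMSEQ_unique by blast
qed

text \<open>
  A Schur test for the Gram matrix of the kernel rows: its entries decay like \<open>1 / (j - l)\<^sup>2\<close>, so
  its row sums are uniformly bounded.
\<close>

lemma hilbert_kernel_combination_norm:
  assumes "finite J"
  shows "(norm (\<Sum>j\<in>J. y j *\<^sub>R hilbert_kernel j))\<^sup>2 \<le> 3 * recip_square_sum * (\<Sum>j\<in>J. (y j)\<^sup>2)"
proof -
  define g where "g d = (if d = 0 then recip_square_sum else 2 * (recip d)\<^sup>2)" for d
  have g_inner: "inner (hilbert_kernel j) (hilbert_kernel l) = g (j - l)" for j l
    using hilbert_kernel_norm hilbert_kernel_inner by (simp add: g_def)
  have g0: "0 \<le> g d" for d by (simp add: g_def recip_square_sum_nonneg)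
  have g_sym: "g (l - j) = g (j - l)" for j l
    by (simp add: g_def power2_eq_square flip: inverse_mult_distrib) (simp add: algebra_simps)
  have g_sum: "(\<Sum>l\<in>J. g (j - l)) \<le> 3 * recip_square_sum" for j
  proof -
    have "(\<Sum>l\<in>J. g (j - l)) \<le> (\<Sum>l\<in>J. (if l = j then recip_square_sum else 0) + 2 * (recip (j - l))\<^sup>2)"
      by (rule sum_mono) (auto simp: g_def)
    also have "\<dots> = (if j \<in> J then recip_square_sum else 0) + 2 * (\<Sum>l\<in>J. (recip (j - l))\<^sup>2)"
      using assms by (simp add: sum.distrib sum_distrib_left)
    also have "\<dots> \<le> recip_square_sum + 2 * recip_square_sum"
      using finite_sum_le_has_sum[OF recip_square_has_sum(2)[of j] assms] recip_square_sum_nonneg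
      by (intro add_mono) auto
    finally show ?thesis by simp
  qed
  have "(norm (\<Sum>j\<in>J. y j *\<^sub>R hilbert_kernel j))\<^sup>2 = (\<Sum>j\<in>J. \<Sum>l\<in>J. y j * y l * g (j - l))"
    by (simp add: power2_norm_eq_inner) (simp add: inner_sum_left inner_sum_right g_inner g_sym sum_distrib_left ac_simps)
  also have "\<dots> \<le> (\<Sum>j\<in>J. \<Sum>l\<in>J. ((y j)\<^sup>2 + (y l)\<^sup>2) / 2 * g (j - l))"
  proof (intro sum_mono mult_right_mono g0)
    show "y j * y l \<le> ((y j)\<^sup>2 + (y l)\<^sup>2) / 2" for j l
      using sum_squares_bound[of "y j" "y l"] by simp
  qed
  also have "\<dots> = (\<Sum>j\<in>J. \<Sum>l\<in>J. (y j)\<^sup>2 * g (j - l)) / 2 + (\<Sum>j\<in>J. \<Sum>l\<in>J. (y l)\<^sup>2 * g (j - l)) / 2"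
    by (simp add: sum_divide_distrib add_divide_distrib distrib_right flip: sum.distrib)
  also have "(\<Sum>j\<in>J. \<Sum>l\<in>J. (y l)\<^sup>2 * g (j - l)) = (\<Sum>j\<in>J. \<Sum>l\<in>J. (y j)\<^sup>2 * g (j - l))"
    by (subst sum.swap) (simp add: g_sym)
  also have "(\<Sum>j\<in>J. \<Sum>l\<in>J. (y j)\<^sup>2 * g (j - l)) / 2 + (\<Sum>j\<in>J. \<Sum>l\<in>J. (y j)\<^sup>2 * g (j - l)) / 2
      = (\<Sum>j\<in>J. (y j)\<^sup>2 * (\<Sum>l\<in>J. g (j - l)))"
    by (simp add: sum_distrib_left)
  also have "\<dots> \<le> (\<Sum>j\<in>J. (y j)\<^sup>2 * (3 * recip_square_sum))"
    by (intro sum_mono mult_left_mono g_sum) auto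
  finally show ?thesis by (simp add: sum_distrib_left ac_simps)
qed

definition hilbert_transform :: "int ell2 \<Rightarrow> int ell2" where
  "hilbert_transform x = Abs_ell2 (\<lambda>j. inner x (hilbert_kernel j))"

text \<open>
  The bound follows from the one for linear combinations of the rows by duality: the sum of the squares
  of \<open>y j = \<langle>x, e j\<rangle>\<close> over a finite set equals \<open>\<langle>x, \<Sum>j. y j e j\<rangle>\<close>.
\<close>

lemma hilbert_transform_nth_inner: "ell2_nth (hilbert_transform x) j = inner x (hilbert_kernel j)"
  and hilbert_transform_norm: "norm (hilbert_transform x) \<le> sqrt (3 * recip_square_sum) * norm x"
proof -
  let ?C = "3 * recip_square_sum"
  have "(\<Sum>j\<in>J. (inner x (hilbert_kernel j))\<^sup>2) \<le> (sqrt ?C * norm x)\<^sup>2" if J: "finite J" for J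
  proof -
    define y where "y j = inner x (hilbert_kernel j)" for j
    define q where "q = (\<Sum>j\<in>J. (y j)\<^sup>2)"
    have "0 \<le> q" unfolding q_def by (rule sum_nonneg) simp
    have "q = inner x (\<Sum>j\<in>J. y j *\<^sub>R hilbert_kernel j)"
      by (simp add: q_def inner_sum_right y_def power2_eq_square)
    also have "\<dots> \<le> norm x * norm (\<Sum>j\<in>J. y j *\<^sub>R hilbert_kernel j)"
      by (rule norm_cauchy_schwarz)
    finally have "q\<^sup>2 \<le> (norm x * norm (\<Sum>j\<in>J. y j *\<^sub>R hilbert_kernel j))\<^sup>2"
      using \<open>0 \<le> q\<close> by (rule power_mono)
    also have "\<dots> \<le> (norm x)\<^sup>2 * (?C * q)"
      unfolding power_mult_distrib q_def
      by (intro mult_left_mono hilbert_kernel_combination_norm J) auto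
    finally have "q * q \<le> (?C * (norm x)\<^sup>2) * q" by (simp add: power2_eq_square ac_simps)
    then have "q \<le> ?C * (norm x)\<^sup>2"
      using \<open>0 \<le> q\<close> recip_square_sum_nonneg
      by (cases "q = 0") (auto simp: mult_le_cancel_right)
    then show ?thesis
      using recip_square_sum_nonneg by (simp add: q_def y_def power_mult_distrib)
  qed
  from ell2_finite_boundI[of _ "sqrt ?C * norm x", OF this]
  show "ell2_nth (hilbert_transform x) j = inner x (hilbert_kernel j)"
    and "norm (hilbert_transform x) \<le> sqrt ?C * norm x"
    by (simp_all add: hilbert_transform_def recip_square_sum_nonneg)
qed

lemma hilbert_transform_nth:
  "((\<lambda>k. ell2_nth x k * recip (k - j)) has_sum ell2_nth (hilbert_transform x) j) UNIV"
  using ell2_inner_has_sum[of x "hilbert_kernel j"]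
  by (simp add: hilbert_transform_nth_inner hilbert_kernel_nth)

lemma linear_hilbert_transform: "linear hilbert_transform"
  by (auto intro!: linearI ell2_eqI simp: hilbert_transform_nth_inner plus_ell2.rep_eq
      scaleR_ell2.rep_eq inner_add_left)

section \<open>Difference quotients and the logarithm of the product\<close>

text \<open>
  The deviations from \<open>1\<close> of the factors \<open>(x k - x j) / ((\<pi> / 2) (k - j))\<close> of the interleaved sequence
  \<open>x k = \<pi> k / 2 + \<rho> k\<close>, as a linear function of \<open>\<rho>\<close>.
\<close>

definition difference_quotients :: "int ell2 \<Rightarrow> (int \<times> int) ell2" where
  "difference_quotients x =
     Abs_ell2 (\<lambda>(j, k). 2 / pi * (ell2_nth x k - ell2_nth x j) * recip (k - j))"

definition difference_quotients_bound :: real where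
  "difference_quotients_bound = sqrt (16 / pi\<^sup>2 * recip_square_sum)"

text \<open>
  Since \<open>(\<rho> k - \<rho> j)\<^sup>2 \<le> 2 (\<rho> j)\<^sup>2 + 2 (\<rho> k)\<^sup>2\<close>, the squares are dominated by two double families that
  differ by a transposition, each with sum \<open>\<parallel>\<rho>\<parallel>\<^sup>2 \<Sum>k. (recip k)\<^sup>2\<close> up to a constant.
\<close>

lemma difference_quotients_nth:
    "ell2_nth (difference_quotients x) (j, k) = 2 / pi * (ell2_nth x k - ell2_nth x j) * recip (k - j)"
  and difference_quotients_norm:
    "norm (difference_quotients x) \<le> difference_quotients_bound * norm x"
proof -
  let ?u = "\<lambda>(j, k). 2 / pi * (ell2_nth x k - ell2_nth x j) * recip (k - j)"
  let ?s = "(norm x)\<^sup>2 * recip_square_sum"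
  have f1: "((\<lambda>(j, k). (ell2_nth x j)\<^sup>2 * (recip (k - j))\<^sup>2) has_sum ?s) (UNIV \<times> UNIV)"
  proof (rule has_sum_SigmaI)
    show row: "((\<lambda>k. case (j, k) of (j, k) \<Rightarrow> (ell2_nth x j)\<^sup>2 * (recip (k - j))\<^sup>2)
        has_sum (ell2_nth x j)\<^sup>2 * recip_square_sum) UNIV" for j
      using has_sum_cmult_right[OF recip_square_has_sum(1)[of j]] by simp
    show tot: "((\<lambda>j. (ell2_nth x j)\<^sup>2 * recip_square_sum) has_sum ?s) UNIV"
      by (rule has_sum_cmult_left[OF ell2_norm_square])
    show "(\<lambda>(j, k). (ell2_nth x j)\<^sup>2 * (recip (k - j))\<^sup>2) summable_on UNIV \<times> UNIV"
      by (rule summable_on_SigmaI[OF row has_sum_imp_summable[OF tot]]) auto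
  qed
  have f2: "((\<lambda>(j, k). (ell2_nth x k)\<^sup>2 * (recip (k - j))\<^sup>2) has_sum ?s) (UNIV \<times> UNIV)"
  proof -
    have "(recip (k - j))\<^sup>2 = (recip (j - k))\<^sup>2" for j k
      by (simp add: power2_eq_square flip: inverse_mult_distrib) (simp add: algebra_simps)
    with f1[THEN has_sum_swap[THEN iffD1]] show ?thesis by (simp add: case_prod_unfold)
  qed
  have dom: "((\<lambda>p. 8 / pi\<^sup>2 * ((\<lambda>(j, k). (ell2_nth x j)\<^sup>2 * (recip (k - j))\<^sup>2) p
      + (\<lambda>(j, k). (ell2_nth x k)\<^sup>2 * (recip (k - j))\<^sup>2) p)) has_sum 8 / pi\<^sup>2 * (?s + ?s)) UNIV"
    using has_sum_cmult_right[OF has_sum_add[OF f1 f2], of "8 / pi\<^sup>2"] by simp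
  have le: "(?u p)\<^sup>2 \<le> 8 / pi\<^sup>2 * ((\<lambda>(j, k). (ell2_nth x j)\<^sup>2 * (recip (k - j))\<^sup>2) p
      + (\<lambda>(j, k). (ell2_nth x k)\<^sup>2 * (recip (k - j))\<^sup>2) p)" for p
  proof (cases p)
    case (Pair j k)
    have "(ell2_nth x k - ell2_nth x j)\<^sup>2 \<le> 2 * ((ell2_nth x j)\<^sup>2 + (ell2_nth x k)\<^sup>2)"
      using zero_le_power2[of "ell2_nth x k + ell2_nth x j"]
      by (simp add: power2_diff power2_sum)
    then have "4 / pi\<^sup>2 * (recip (k - j))\<^sup>2 * (ell2_nth x k - ell2_nth x j)\<^sup>2
        \<le> 4 / pi\<^sup>2 * (recip (k - j))\<^sup>2 * (2 * ((ell2_nth x j)\<^sup>2 + (ell2_nth x k)\<^sup>2))"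
      by (rule mult_left_mono) simp
    also have "4 / pi\<^sup>2 * (recip (k - j))\<^sup>2 * (ell2_nth x k - ell2_nth x j)\<^sup>2 = (?u p)\<^sup>2"
      unfolding Pair prod.case power_mult_distrib power_divide by simp
    finally show ?thesis
      by (simp add: Pair algebra_simps add_divide_distrib)
  qed
  have s: "(\<lambda>p. (?u p)\<^sup>2) summable_on UNIV"
    by (rule summable_on_comparison_test[OF has_sum_imp_summable[OF dom] le]) auto
  have "(\<Sum>\<^sub>\<infinity>p. (?u p)\<^sup>2) \<le> 8 / pi\<^sup>2 * (?s + ?s)"
    by (rule has_sum_mono[OF has_sum_infsum[OF s] dom le])
  also have "\<dots> = (difference_quotients_bound * norm x)\<^sup>2"
    using recip_square_sum_nonneg
    by (simp add: difference_quotients_bound_def power_mult_distrib)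
  finally have total: "(\<Sum>\<^sub>\<infinity>p. (?u p)\<^sup>2) \<le> (difference_quotients_bound * norm x)\<^sup>2" .
  have nonneg: "0 \<le> difference_quotients_bound * norm x"
    by (simp add: difference_quotients_bound_def recip_square_sum_nonneg)
  note * = ell2_normI[OF s total nonneg]
  show "ell2_nth (difference_quotients x) (j, k) = 2 / pi * (ell2_nth x k - ell2_nth x j) * recip (k - j)"
    and "norm (difference_quotients x) \<le> difference_quotients_bound * norm x"
    unfolding difference_quotients_def using *(2) by (simp_all only: *(1) prod.case)
qed

lemma linear_difference_quotients: "linear difference_quotients"
proof (rule linearI)
  show "difference_quotients (x + y) = difference_quotients x + difference_quotients y" for x y
  proof (rule ell2_eqI)
    show "ell2_nth (difference_quotients (x + y)) p
        = ell2_nth (difference_quotients x + difference_quotients y) p" for p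
      by (cases p) (simp add: difference_quotients_nth plus_ell2.rep_eq algebra_simps)
  qed
  show "difference_quotients (r *\<^sub>R x) = r *\<^sub>R difference_quotients x" for r x
  proof (rule ell2_eqI)
    show "ell2_nth (difference_quotients (r *\<^sub>R x)) p = ell2_nth (r *\<^sub>R difference_quotients x) p" for p
      by (cases p) (simp add: difference_quotients_nth scaleR_ell2.rep_eq algebra_simps)
  qed
qed

definition log_defect :: "real \<Rightarrow> real" where
  "log_defect u = ln (1 + u) - u"

text \<open>
  The derivative of \<open>ln (1 + u) - u\<close> is \<open>- u / (1 + u)\<close>, so the mean value theorem produces an additional
  small factor.
\<close>

lemma log_defect_difference:
  assumes "0 < c" and "c \<le> 1 + u" and "c \<le> 1 + u'"
  shows "\<bar>log_defect u - log_defect u'\<bar> \<le> (\<bar>u\<bar> + \<bar>u'\<bar>) / c * \<bar>u - u'\<bar>"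
  using assms(2,3)
proof (induction u u' rule: linorder_wlog)
  case (sym u u')
  then show ?case by (simp add: abs_minus_commute add.commute)
next
  case (le u u')
  show ?case
  proof (cases "u = u'")
    case False
    with le have "u < u'" by simp
    have "(log_defect has_real_derivative - (t / (1 + t))) (at t)" if "u \<le> t" "t \<le> u'" for t
    proof -
      have "0 < 1 + t" using that le assms(1) by linarith
      then have "((\<lambda>u. ln (1 + u) - u) has_real_derivative - (t / (1 + t))) (at t)"
        by (auto intro!: derivative_eq_intros simp: field_simps)
      then show ?thesis by (simp add: log_defect_def[abs_def])
    qed
    from MVT2[OF \<open>u < u'\<close> this] obtain t where t: "u < t" "t < u'"
      and eq: "log_defect u' - log_defect u = (u' - u) * - (t / (1 + t))" by blast
    have "c \<le> 1 + t" using t le by linarith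
    then have "\<bar>t / (1 + t)\<bar> \<le> (\<bar>u\<bar> + \<bar>u'\<bar>) / c"
      unfolding abs_divide using t assms(1) by (intro frac_le) auto
    then have "\<bar>u' - u\<bar> * \<bar>t / (1 + t)\<bar> \<le> \<bar>u' - u\<bar> * ((\<bar>u\<bar> + \<bar>u'\<bar>) / c)"
      by (rule mult_left_mono) simp
    moreover have "\<bar>log_defect u - log_defect u'\<bar> = \<bar>u' - u\<bar> * \<bar>t / (1 + t)\<bar>"
      unfolding abs_minus_commute[of "log_defect u"] eq by (simp add: abs_mult)
    ultimately show ?thesis by (simp add: abs_minus_commute mult.commute)
  qed simp
qed

text \<open>
  A closed convex condition on \<open>\<rho>\<close> that separated spectral data satisfy; all estimates are uniform on
  its intersection with a ball.
\<close>

definition factors_ge :: "real \<Rightarrow> int ell2 set" where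
  "factors_ge c = {x. \<forall>p. c \<le> 1 + ell2_nth (difference_quotients x) p}"

lemma factors_geD: "x \<in> factors_ge c \<Longrightarrow> c \<le> 1 + ell2_nth (difference_quotients x) p"
  unfolding factors_ge_def by blast

text \<open>
  The logarithm of the product of the factors \<open>1 + u j k\<close> over \<open>k\<close>, with the sum of the linear terms
  evaluated as a principal value.
\<close>

definition log_product :: "int ell2 \<Rightarrow> int \<Rightarrow> real" where
  "log_product x j = 2 / pi * ell2_nth (hilbert_transform x) j
     + (\<Sum>\<^sub>\<infinity>k. log_defect (ell2_nth (difference_quotients x) (j, k)))"

lemma difference_quotients_zero: "difference_quotients 0 = 0"
  using linear_0[OF linear_difference_quotients] .

lemma zero_in_factors_ge: "c \<le> 1 \<Longrightarrow> 0 \<in> factors_ge c"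
  by (simp add: factors_ge_def difference_quotients_zero zero_ell2.rep_eq)

lemma log_product_zero: "log_product 0 j = 0"
  by (simp add: log_product_def difference_quotients_zero linear_0[OF linear_hilbert_transform]
      zero_ell2.rep_eq log_defect_def)

text \<open>
  The divided difference of the defect is square-summable as well, being dominated by the two matrices
  of difference quotients.
\<close>

lemma log_defect_difference_quotients:
  assumes "0 < c" and x: "x \<in> factors_ge c" and y: "y \<in> factors_ge c"
  shows "\<exists>Q. norm Q \<le> (norm (difference_quotients x) + norm (difference_quotients y)) / c \<and>
     (\<forall>p. log_defect (ell2_nth (difference_quotients x) p) - log_defect (ell2_nth (difference_quotients y) p)
        = ell2_nth (difference_quotients (x - y)) p * ell2_nth Q p)"
proof -
  let ?u = "ell2_nth (difference_quotients x)" and ?u' = "ell2_nth (difference_quotients y)"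
  define A where "A = (\<lambda>z :: (int \<times> int) ell2. Abs_ell2 (\<lambda>p. \<bar>ell2_nth z p\<bar>))"
  have A: "ell2_nth (A z) p = \<bar>ell2_nth z p\<bar>" "norm (A z) \<le> norm z" for z p
    using ell2_dominatedI[of "\<lambda>p. \<bar>ell2_nth z p\<bar>" 1 z] by (simp_all add: A_def)
  let ?q = "\<lambda>p. (log_defect (?u p) - log_defect (?u' p)) / (?u p - ?u' p)"
  let ?S = "A (difference_quotients x) + A (difference_quotients y)"
  have q_le: "\<bar>?q p\<bar> \<le> 1 / c * \<bar>ell2_nth ?S p\<bar>" for p
  proof (cases "?u p = ?u' p")
    case False
    have "\<bar>log_defect (?u p) - log_defect (?u' p)\<bar> \<le> (\<bar>?u p\<bar> + \<bar>?u' p\<bar>) / c * \<bar>?u p - ?u' p\<bar>"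
      by (intro log_defect_difference \<open>0 < c\<close> factors_geD x y)
    with False show ?thesis
      by (simp add: abs_divide divide_le_eq plus_ell2.rep_eq A)
  qed (use \<open>0 < c\<close> in simp)
  define Q where "Q = Abs_ell2 ?q"
  have Q: "ell2_nth Q = ?q" "norm Q \<le> 1 / c * norm ?S"
    using ell2_dominatedI[of ?q, OF q_le] \<open>0 < c\<close> by (simp_all add: Q_def)
  have "norm ?S \<le> norm (difference_quotients x) + norm (difference_quotients y)"
    by (rule order_trans[OF norm_triangle_ineq add_mono[OF A(2) A(2)]])
  then have "1 / c * norm ?S \<le> (norm (difference_quotients x) + norm (difference_quotients y)) / c"
    using \<open>0 < c\<close> by (simp add: divide_right_mono)
  moreover have "ell2_nth (difference_quotients (x - y)) p = ?u p - ?u' p" for p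
    by (simp add: linear_diff[OF linear_difference_quotients] minus_ell2.rep_eq)
  ultimately show ?thesis
    using Q by (intro exI[of _ Q]) (auto simp: log_defect_def)
qed

text \<open>
  Comparison with \<open>y = 0\<close> writes each row as an inner product of square-summable rows.
\<close>

lemma log_defect_row_summable:
  assumes "0 < c" "c \<le> 1" and x: "x \<in> factors_ge c"
  shows "(\<lambda>k. log_defect (ell2_nth (difference_quotients x) (j, k))) summable_on UNIV"
proof -
  obtain Q where "\<And>p. log_defect (ell2_nth (difference_quotients x) p)
      - log_defect (ell2_nth (difference_quotients 0) p) = ell2_nth (difference_quotients (x - 0)) p * ell2_nth Q p"
    using log_defect_difference_quotients[OF assms(1) x zero_in_factors_ge[OF assms(2)]] by blast
  then have eq: "log_defect (ell2_nth (difference_quotients x) p) = ell2_nth (difference_quotients x) p * ell2_nth Q p" for p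
    by (simp add: difference_quotients_zero zero_ell2.rep_eq log_defect_def)
  show ?thesis
    unfolding eq by (rule has_sum_imp_summable[OF ell2_row_inner_nth])
qed

definition log_product_lipschitz :: "real \<Rightarrow> real \<Rightarrow> real" where
  "log_product_lipschitz c r =
     2 / pi * sqrt (3 * recip_square_sum) + difference_quotients_bound\<^sup>2 * (2 * r) / c"

lemma log_product_lipschitz_nonneg: "0 < c \<Longrightarrow> 0 \<le> r \<Longrightarrow> 0 \<le> log_product_lipschitz c r"
  by (simp add: log_product_lipschitz_def recip_square_sum_nonneg)

lemma difference_quotients_bound_nonneg: "0 \<le> difference_quotients_bound"
  by (simp add: difference_quotients_bound_def recip_square_sum_nonneg)

text \<open>
  The difference is the Hilbert transform of \<open>x - y\<close> plus the row-wise inner product of the difference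
  quotients of \<open>x - y\<close> with the divided differences of the defect. With \<open>y = 0\<close> this also shows that
  \<open>log_product x\<close> is square-summable.
\<close>

lemma log_product_difference:
  assumes c: "0 < c" "c \<le> 1" and x: "x \<in> factors_ge c" "norm x \<le> r" and y: "y \<in> factors_ge c" "norm y \<le> r"
  shows "\<exists>z. (\<forall>j. ell2_nth z j = log_product x j - log_product y j) \<and>
    norm z \<le> log_product_lipschitz c r * norm (x - y)"
proof -
  let ?b = difference_quotients_bound
  obtain Q where Q: "norm Q \<le> (norm (difference_quotients x) + norm (difference_quotients y)) / c"
    and eq: "\<And>p. log_defect (ell2_nth (difference_quotients x) p)
      - log_defect (ell2_nth (difference_quotients y) p) = ell2_nth (difference_quotients (x - y)) p * ell2_nth Q p"
    using log_defect_difference_quotients[OF c(1) x(1) y(1)] by blast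
  define z where "z = (2 / pi) *\<^sub>R hilbert_transform (x - y) + ell2_row_inner (difference_quotients (x - y)) Q"
  have "ell2_nth z j = log_product x j - log_product y j" for j
  proof -
    have "((\<lambda>k. log_defect (ell2_nth (difference_quotients x) (j, k)) + - log_defect (ell2_nth (difference_quotients y) (j, k)))
        has_sum (\<Sum>\<^sub>\<infinity>k. log_defect (ell2_nth (difference_quotients x) (j, k)))
          + - (\<Sum>\<^sub>\<infinity>k. log_defect (ell2_nth (difference_quotients y) (j, k)))) UNIV"
      by (intro has_sum_add has_sum_uminusI has_sum_infsum log_defect_row_summable[OF c] x y)
    moreover have "((\<lambda>k. log_defect (ell2_nth (difference_quotients x) (j, k)) + - log_defect (ell2_nth (difference_quotients y) (j, k)))
        has_sum ell2_nth (ell2_row_inner (difference_quotients (x - y)) Q) j) UNIV"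
      using ell2_row_inner_nth[of "difference_quotients (x - y)" j Q] eq by simp
    ultimately show ?thesis
      using has_sum_unique
      by (fastforce simp: z_def log_product_def plus_ell2.rep_eq minus_ell2.rep_eq scaleR_ell2.rep_eq
          linear_diff[OF linear_hilbert_transform] algebra_simps diff_divide_distrib)
  qed
  moreover have "norm z \<le> log_product_lipschitz c r * norm (x - y)"
  proof -
    have U_le: "norm (difference_quotients z) \<le> ?b * r" if "norm z \<le> r" for z
      using difference_quotients_norm[of z] mult_left_mono[OF that difference_quotients_bound_nonneg]
      by linarith
    have "norm Q \<le> (?b * r + ?b * r) / c"
      using Q U_le[OF x(2)] U_le[OF y(2)] c(1)
      by (meson add_mono divide_right_mono less_imp_le order_trans)
    then have "norm (ell2_row_inner (difference_quotients (x - y)) Q)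
        \<le> (?b * norm (x - y)) * ((?b * r + ?b * r) / c)"
      using difference_quotients_bound_nonneg
      by (intro order_trans[OF ell2_row_inner_norm] mult_mono difference_quotients_norm) auto
    moreover have "norm ((2 / pi) *\<^sub>R hilbert_transform (x - y))
        \<le> 2 / pi * (sqrt (3 * recip_square_sum) * norm (x - y))"
      unfolding norm_scaleR by (intro mult_mono hilbert_transform_norm) (auto simp: recip_square_sum_nonneg)
    ultimately show ?thesis
      unfolding z_def log_product_lipschitz_def
      by (intro order_trans[OF norm_triangle_ineq])
         (simp add: algebra_simps power2_eq_square add_divide_distrib)
  qed
  ultimately show ?thesis by blast
qed

lemma exp_neg_difference:
  fixes s t :: real
  assumes "\<bar>s\<bar> \<le> R" and "\<bar>t\<bar> \<le> R"
  shows "\<bar>exp (- s) - exp (- t)\<bar> \<le> exp R * \<bar>s - t\<bar>"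
  using assms
proof (induction s t rule: linorder_wlog)
  case (sym s t)
  then show ?case by (simp add: abs_minus_commute)
next
  case (le s t)
  have "exp (- s) * (1 - exp (- (t - s))) \<le> exp R * (t - s)"
  proof (rule mult_mono)
    show "1 - exp (- (t - s)) \<le> t - s"
      using exp_ge_add_one_self[of "- (t - s)"] by linarith
  qed (use le in auto)
  moreover have "exp (- s) * (1 - exp (- (t - s))) = exp (- s) - exp (- t)"
    by (simp add: right_diff_distrib flip: exp_add)
  moreover have "exp (- t) \<le> exp (- s)" using le by simp
  ultimately show ?case using le by (simp add: abs_if)
qed

text \<open>
  Only the even positions \<open>j = 2 n\<close>, which carry the numbers \<open>\<lambda> n\<close>, give norming constants.
\<close>

definition exp_neg_log_product :: "int ell2 \<Rightarrow> int ell2" where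
  "exp_neg_log_product x = Abs_ell2 (\<lambda>n. exp (- log_product x (2 * n)) - 1)"

lemma inj_double: "inj (\<lambda>n :: int. 2 * n)"
  by (simp add: inj_on_def)

lemma log_product_bound:
  assumes c: "0 < c" "c \<le> 1" and x: "x \<in> factors_ge c" "norm x \<le> r"
  shows "\<bar>log_product x j\<bar> \<le> log_product_lipschitz c r * r"
proof -
  have "0 \<le> r" using x(2) norm_ge_zero order_trans by blast
  obtain z where "ell2_nth z j = log_product x j" "norm z \<le> log_product_lipschitz c r * norm x"
    using log_product_difference[OF c x zero_in_factors_ge] c \<open>0 \<le> r\<close> by (auto simp: log_product_zero)
  with ell2_nth_le_norm[of z j] mult_left_mono[OF x(2) log_product_lipschitz_nonneg[OF c(1) \<open>0 \<le> r\<close>]]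
  show ?thesis by simp
qed

lemma exp_neg_log_product_nth:
  assumes c: "0 < c" "c \<le> 1" and x: "x \<in> factors_ge c"
  shows "(\<lambda>n. (exp (- log_product x (2 * n)) - 1)\<^sup>2) summable_on UNIV"
    and "ell2_nth (exp_neg_log_product x) n = exp (- log_product x (2 * n)) - 1"
proof -
  let ?R = "log_product_lipschitz c (norm x) * norm x"
  obtain z where z: "\<And>j. ell2_nth z j = log_product x j"
    using log_product_difference[OF c x order_refl zero_in_factors_ge] c by (auto simp: log_product_zero)
  have "\<bar>exp (- log_product x (2 * n)) - 1\<bar> \<le> exp ?R * \<bar>ell2_nth (ell2_reindex (\<lambda>n. 2 * n) z) n\<bar>" for n
    using exp_neg_difference[of "log_product x (2 * n)" ?R 0]
      log_product_bound[OF c x order_refl]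
      mult_nonneg_nonneg[OF log_product_lipschitz_nonneg[OF c(1) norm_ge_zero] norm_ge_zero, of x x]
    by (simp add: ell2_reindex_nth[OF inj_double] z)
  from ell2_dominatedI(1)[of _ "exp ?R", OF this]
  have nth: "ell2_nth (exp_neg_log_product x) = (\<lambda>n. exp (- log_product x (2 * n)) - 1)"
    by (simp add: exp_neg_log_product_def)
  then show "ell2_nth (exp_neg_log_product x) n = exp (- log_product x (2 * n)) - 1" by simp
  show "(\<lambda>n. (exp (- log_product x (2 * n)) - 1)\<^sup>2) summable_on UNIV"
    using ell2_nth_summable[of "exp_neg_log_product x"] by (simp add: nth)
qed

lemma exp_neg_log_product_lipschitz:
  assumes c: "0 < c" "c \<le> 1" and x: "x \<in> factors_ge c" "norm x \<le> r" and y: "y \<in> factors_ge c" "norm y \<le> r"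
  shows "norm (exp_neg_log_product x - exp_neg_log_product y)
    \<le> exp (log_product_lipschitz c r * r) * log_product_lipschitz c r * norm (x - y)"
proof -
  let ?R = "log_product_lipschitz c r * r"
  obtain z where z: "\<And>j. ell2_nth z j = log_product x j - log_product y j"
    and z_le: "norm z \<le> log_product_lipschitz c r * norm (x - y)"
    using log_product_difference[OF c x y] by blast
  let ?d = "exp_neg_log_product x - exp_neg_log_product y"
  have "\<bar>ell2_nth ?d n\<bar> \<le> exp ?R * \<bar>ell2_nth (ell2_reindex (\<lambda>n. 2 * n) z) n\<bar>" for n
    using exp_neg_difference[OF log_product_bound[OF c x, of "2 * n"] log_product_bound[OF c y, of "2 * n"]]
    by (simp add: minus_ell2.rep_eq exp_neg_log_product_nth(2)[OF c x(1)]
        exp_neg_log_product_nth(2)[OF c y(1)] ell2_reindex_nth[OF inj_double] z)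
  from ell2_dominatedI(2)[of "ell2_nth ?d", OF this]
  have "norm ?d \<le> exp ?R * norm (ell2_reindex (\<lambda>n. 2 * n) z)"
    by (simp add: ell2_nth_inverse)
  also have "\<dots> \<le> exp ?R * norm z"
    by (intro mult_left_mono ell2_reindex_norm inj_double) simp
  also have "\<dots> \<le> exp ?R * (log_product_lipschitz c r * norm (x - y))"
    by (intro mult_left_mono z_le) simp
  finally show ?thesis by (simp add: mult.assoc)
qed

text \<open>
  The coefficients of \<open>(ln (1 + t) - t) / t\<close>.
\<close>

definition log_defect_coeff :: "nat \<Rightarrow> real" where
  "log_defect_coeff m = (- 1) ^ Suc m / real (m + 2)"

lemma log_defect_coeff_summable:
  assumes "0 \<le> K" and "K < 1"
  shows "(\<lambda>m. \<bar>log_defect_coeff m\<bar> * K ^ Suc m) summable_on UNIV"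
proof (rule summable_on_comparison_test)
  show "(\<lambda>m. K ^ Suc m) summable_on UNIV"
    by (rule norm_summable_imp_summable_on) (use assms in \<open>simp add: norm_mult norm_power summable_mult\<close>)
  show "\<bar>log_defect_coeff m\<bar> * K ^ Suc m \<le> K ^ Suc m" for m
    using assms by (intro mult_left_le_one_le) (auto simp: log_defect_coeff_def abs_divide power_abs)
qed (use assms in auto)

lemma log_defect_series:
  assumes "\<bar>t\<bar> < 1" and s: "((\<lambda>m. log_defect_coeff m * t ^ Suc m) has_sum s) UNIV"
  shows "log_defect t = t * s"
proof -
  let ?f = "\<lambda>n. (- 1) ^ n * (1 / real (n + 1)) * t ^ Suc n"
  have "(\<lambda>m. t * (log_defect_coeff m * t ^ Suc m)) sums (t * s)"
    by (rule sums_mult[OF has_sum_imp_sums[OF s]])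
  also have "(\<lambda>m. t * (log_defect_coeff m * t ^ Suc m)) = (\<lambda>m. ?f (Suc m))"
    by (simp add: fun_eq_iff log_defect_coeff_def field_simps)
  finally have "?f sums (t * s + ?f 0)"
    by (subst (asm) sums_Suc_iff)
  then have "(\<Sum>n. ?f n) = t * s + t" by (simp add: sums_iff)
  moreover have "ln (1 + t) = (\<Sum>n. ?f n)"
    using ln_series[of "1 + t"] assms(1) by simp
  ultimately show ?thesis by (simp add: log_defect_def)
qed

lemma exp_minus_one_series:
  fixes t :: real
  assumes s: "((\<lambda>m. 1 / fact (Suc m) * t ^ Suc m) has_sum s) UNIV"
  shows "exp t - 1 = s"
proof -
  have "(\<lambda>n. t ^ n /\<^sub>R fact n) sums (s + t ^ 0 /\<^sub>R fact 0)"
    using has_sum_imp_sums[OF s] by (subst sums_Suc_iff[symmetric]) (simp add: divide_inverse ac_simps)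
  with exp_converges[of t] have "exp t = s + 1" using sums_unique2 by fastforce
  then show ?thesis by simp
qed

lemma exp_coeff_summable: "(\<lambda>m. \<bar>1 / fact (Suc m)\<bar> * K ^ Suc m :: real) summable_on UNIV" if "0 \<le> K"
proof -
  have "summable (\<lambda>n. inverse (fact (Suc n)) * K ^ Suc n :: real)"
    using summable_exp[of K] by (subst summable_Suc_iff)
  then show ?thesis
    using that by (intro norm_summable_imp_summable_on)
      (simp add: divide_inverse abs_mult power_abs del: fact_Suc power_Suc)
qed

text \<open>
  Let \<open>W v = u v / (1 + u a)\<close>. The factors at \<open>a + v\<close> are \<open>(1 + u a) (1 + W v)\<close>, hence
  \<open>\<phi> (u (a + v)) = \<phi> (u a) + W v (\<psi> (W v) - u a)\<close> with \<open>\<psi> t = (ln (1 + t) - t) / t\<close>. Summation over \<open>k\<close>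
  is a row-wise inner product, and \<open>\<psi>\<close> acts on \<open>W v\<close> by its power series. Extracting one factor \<open>W v\<close>
  before summing avoids any interchange of the sum over \<open>k\<close> with the power series.
\<close>

lemma log_product_power_series:
  assumes "0 < c" and "c \<le> 1" and a: "a \<in> factors_ge c"
  shows "\<exists>\<delta>>0. \<exists>G K. power_series_le G \<delta> K \<and>
    (\<forall>v. norm v < \<delta> \<longrightarrow> (\<forall>j. ell2_nth (G v) j = log_product (a + v) j))"
proof -
  let ?U = difference_quotients
  define w where "w = difference_quotients_bound / c"
  have "0 \<le> w" using \<open>0 < c\<close> difference_quotients_bound_nonneg by (simp add: w_def)
  \<comment> \<open>Small enough for all entries of \<open>W v\<close> to be at most \<open>1 / 2\<close>, inside the disc of convergence of \<open>\<psi>\<close>.\<close>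
  define \<delta> where "\<delta> = 1 / (2 * (w + 1))"
  have "0 < \<delta>" and w\<delta>: "w * \<delta> \<le> 1 / 2" using \<open>0 \<le> w\<close> by (auto simp: \<delta>_def field_simps)
  have ge: "c \<le> 1 + ell2_nth (?U a) p" for p by (rule factors_geD[OF a])
  define W where "W v = Abs_ell2 (\<lambda>p. ell2_nth (?U v) p / (1 + ell2_nth (?U a) p))" for v
  have dom: "\<bar>ell2_nth (?U v) p / (1 + ell2_nth (?U a) p)\<bar> \<le> 1 / c * \<bar>ell2_nth (?U v) p\<bar>" for v p
    using ge[of p] \<open>0 < c\<close> by (simp add: abs_divide frac_le)
  have W_nth: "ell2_nth (W v) p = ell2_nth (?U v) p / (1 + ell2_nth (?U a) p)" for v p
    using ell2_dominatedI(1)[of _ "1 / c", OF dom] \<open>0 < c\<close> by (simp add: W_def)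
  have W_norm: "norm (W v) \<le> w * norm v" for v
  proof -
    have "norm (W v) \<le> 1 / c * norm (?U v)"
      using ell2_dominatedI(2)[of _ "1 / c", OF dom] \<open>0 < c\<close> by (simp add: W_def)
    also have "\<dots> \<le> 1 / c * (difference_quotients_bound * norm v)"
      using \<open>0 < c\<close> by (intro mult_left_mono difference_quotients_norm) auto
    finally show ?thesis by (simp add: w_def)
  qed
  have "linear W"
    by (rule linearI) (auto intro!: ell2_eqI simp: W_nth plus_ell2.rep_eq scaleR_ell2.rep_eq
        linear_add[OF linear_difference_quotients] linear_scale[OF linear_difference_quotients] add_divide_distrib)
  then have W_series: "power_series_le W \<delta> (1 / 2)"
    using power_series_le_mono[OF power_series_le_linear[OF _ W_norm \<open>0 \<le> w\<close>] w\<delta>] by blast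
  define \<Psi> where "\<Psi> v = ell2_coordinate_series log_defect_coeff (W v)" for v
  have coeff: "(\<lambda>m. \<bar>log_defect_coeff m\<bar> * (1 / 2) ^ Suc m) summable_on UNIV"
    by (rule log_defect_coeff_summable) auto
  obtain L where \<Psi>_series: "power_series_le \<Psi> \<delta> L"
    using power_series_le_coordinate_series[OF W_series \<open>0 < \<delta>\<close> coeff] unfolding \<Psi>_def by blast
  define f where "f = Abs_ell2 (log_product a)"
  obtain z where "\<forall>j. ell2_nth z j = log_product a j"
    using log_product_difference[OF assms order_refl zero_in_factors_ge] assms by (auto simp: log_product_zero)
  then have "log_product a = ell2_nth z" by auto
  then have f_nth: "ell2_nth f j = log_product a j" for j by (simp add: f_def ell2_nth_inverse)
  define G where "G v = f + ((2 / pi) *\<^sub>R hilbert_transform v + ell2_row_inner (W v) (\<Psi> v + (- ?U a)))" for v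
  have "\<exists>K. power_series_le G \<delta> K"
    unfolding G_def
    by (rule exI, rule power_series_le_add[OF power_series_le_const power_series_le_add[OF
            power_series_le_scaleR[OF power_series_le_linear[OF linear_hilbert_transform hilbert_transform_norm]]
            power_series_le_bilinear[OF W_series power_series_le_add[OF \<Psi>_series power_series_le_const]
              _ bounded_bilinear_ell2_row_inner ell2_row_inner_norm]]])
       (simp_all add: \<open>0 < \<delta>\<close> recip_square_sum_nonneg)
  moreover have "ell2_nth (G v) j = log_product (a + v) j" if v: "norm v < \<delta>" for v j
  proof -
    have W_half: "norm (W v) \<le> 1 / 2"
      using power_series_le_bound[OF W_series v] .
    have split: "log_defect (ell2_nth (?U (a + v)) p)
        = log_defect (ell2_nth (?U a) p) + ell2_nth (W v) p * ell2_nth (\<Psi> v + (- ?U a)) p" for p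
    proof -
      define u where "u = ell2_nth (?U a) p"
      define t where "t = ell2_nth (W v) p"
      have t: "\<bar>t\<bar> < 1" using ell2_nth_le_norm[of "W v" p] W_half by (simp add: t_def)
      have u: "0 < 1 + u" using ge[of p] \<open>0 < c\<close> by (simp add: u_def)
      have sum: "ell2_nth (?U (a + v)) p = u + (1 + u) * t"
        using u by (simp add: t_def u_def W_nth linear_add[OF linear_difference_quotients] plus_ell2.rep_eq)
      have "log_defect t = t * ell2_nth (\<Psi> v) p"
        using log_defect_series[OF t] ell2_coordinate_series_nth[OF coeff W_half, of p]
        by (simp add: \<Psi>_def t_def)
      moreover have "1 + (u + (1 + u) * t) = (1 + u) * (1 + t)" by (simp add: algebra_simps)
      then have "ln (1 + (u + (1 + u) * t)) = ln (1 + u) + ln (1 + t)"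
        using u t by (simp add: ln_mult)
      ultimately show ?thesis
        unfolding sum by (simp add: log_defect_def plus_ell2.rep_eq minus_ell2.rep_eq flip: u_def t_def)
          (simp add: algebra_simps)
    qed
    have "((\<lambda>k. log_defect (ell2_nth (?U (a + v)) (j, k))) has_sum
        (\<Sum>\<^sub>\<infinity>k. log_defect (ell2_nth (?U a) (j, k))) + ell2_nth (ell2_row_inner (W v) (\<Psi> v + (- ?U a))) j) UNIV"
      unfolding split
      by (intro has_sum_add has_sum_infsum log_defect_row_summable[OF assms] ell2_row_inner_nth)
    from infsumI[OF this] show ?thesis
      by (simp add: G_def log_product_def plus_ell2.rep_eq scaleR_ell2.rep_eq f_nth
          linear_add[OF linear_hilbert_transform] algebra_simps add_divide_distrib)
  qed
  ultimately show ?thesis using \<open>0 < \<delta>\<close> by blast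
qed

text \<open>
  Substitute the power series of the logarithm into the series of \<open>exp t - 1\<close> and keep the even
  positions.
\<close>

lemma exp_neg_log_product_power_series:
  assumes "0 < c" and "c \<le> 1" and a: "a \<in> factors_ge c"
  shows "\<exists>\<delta>>0. \<exists>F. power_series_on_ball F a \<delta> \<and> (\<forall>x\<in>ball a \<delta>. F x = exp_neg_log_product x)"
proof -
  obtain \<delta> G K where "0 < \<delta>" and G: "power_series_le G \<delta> K"
    and G_nth: "\<And>v j. norm v < \<delta> \<Longrightarrow> ell2_nth (G v) j = log_product (a + v) j"
    using log_product_power_series[OF assms] by blast
  have "norm (G 0) \<le> K" using power_series_le_bound[OF G, of 0] \<open>0 < \<delta>\<close> by simp
  then have "0 \<le> K" using norm_ge_zero order_trans by blast
  define E where "E v = ell2_coordinate_series (\<lambda>m. 1 / fact (Suc m)) ((- 1) *\<^sub>R G v)" for v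
  have negG: "power_series_le (\<lambda>v. (- 1) *\<^sub>R G v) \<delta> K"
    using power_series_le_scaleR[OF G \<open>0 < \<delta>\<close>, of "- 1"] by simp
  obtain L where "power_series_le E \<delta> L"
    using power_series_le_coordinate_series[OF negG \<open>0 < \<delta>\<close> exp_coeff_summable[OF \<open>0 \<le> K\<close>]]
    unfolding E_def by blast
  from power_series_le_imp_power_series_on_ball[OF power_series_le_compose_linear[OF this \<open>0 < \<delta>\<close>
      linear_ell2_reindex[OF inj_double] ell2_reindex_norm[OF inj_double]] \<open>0 < \<delta>\<close>]
  have "power_series_on_ball (\<lambda>x. ell2_reindex (\<lambda>n. 2 * n) (E (x - a))) a \<delta>" .
  moreover have "ell2_reindex (\<lambda>n. 2 * n) (E (x - a)) = exp_neg_log_product x" if "x \<in> ball a \<delta>" for x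
  proof -
    have v: "norm (x - a) < \<delta>" using that by (simp add: dist_norm norm_minus_commute)
    have "ell2_nth (E (x - a)) j = exp (- log_product x j) - 1" for j
      using exp_minus_one_series[OF ell2_coordinate_series_nth[OF exp_coeff_summable[OF \<open>0 \<le> K\<close>]
            power_series_le_bound[OF negG v]], of j]
      by (simp add: E_def uminus_ell2.rep_eq G_nth[OF v])
    then have "(\<lambda>n. exp (- log_product x (2 * n)) - 1) = ell2_nth (ell2_reindex (\<lambda>n. 2 * n) (E (x - a)))"
      by (simp add: ell2_reindex_nth[OF inj_double] fun_eq_iff)
    then show ?thesis by (simp add: exp_neg_log_product_def ell2_nth_inverse)
  qed
  ultimately show ?thesis using \<open>0 < \<delta>\<close> by blast
qed

section \<open>Symmetric products\<close>

lemma prod_symmetric_interval: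
  fixes g :: "int \<Rightarrow> 'a::comm_monoid_mult"
  shows "(\<Prod>m\<in>{- int N..int N} - {0}. g m) = (\<Prod>m<N. g (int m + 1) * g (- (int m + 1)))"
proof (induction N)
  case (Suc N)
  have "{- int (Suc N)..int (Suc N)} - {0}
      = insert (int N + 1) (insert (- (int N + 1)) ({- int N..int N} - {0}))" by auto
  then show ?case by (simp add: Suc ac_simps)
qed simp

text \<open>
  Pairing the factors at \<open>M\<close> and \<open>- M\<close> makes the product absolutely convergent: with
  \<open>A = \<pi> (M + \<theta>)\<close> and \<open>B = \<pi> (- M + \<theta>)\<close> the term linear in \<open>z\<close> is \<open>z (A + B) / (A B)\<close>, and
  \<open>A + B = 2 \<pi> \<theta>\<close> does not grow with \<open>M\<close>.
\<close>

lemma paired_factor_deviation: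
  fixes \<sigma> \<sigma>' \<theta> M :: real and z :: complex
  assumes M: "1 \<le> M" and \<theta>: "\<bar>\<theta>\<bar> \<le> 1 / 2" and z: "norm z \<le> R"
  shows "norm ((of_real (pi * (M + \<theta>) + \<sigma>) - z) / of_real (pi * (M + \<theta>)) *
      ((of_real (pi * (- M + \<theta>) + \<sigma>') - z) / of_real (pi * (- M + \<theta>))) - 1)
    \<le> 2 * \<sigma>\<^sup>2 + 2 * \<sigma>'\<^sup>2 + (2 + 4 * R + 2 * R\<^sup>2) * (inverse M)\<^sup>2"
proof -
  define A where "A = pi * (M + \<theta>)"
  define B where "B = pi * (- M + \<theta>)"
  have pi2: "2 < pi" using pi_gt3 by simp
  have half: "M / 2 \<le> M + \<theta>" "M / 2 \<le> M - \<theta>" using M \<theta> by (auto simp: abs_if split: if_splits)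
  have "2 * (M / 2) \<le> pi * (M + \<theta>)" "2 * (M / 2) \<le> pi * (M - \<theta>)"
    using half pi2 M by (intro mult_mono; simp)+
  then have AM: "M \<le> \<bar>A\<bar>" and BM: "M \<le> \<bar>B\<bar>"
    unfolding A_def B_def by (auto simp: algebra_simps)
  then have nz: "A \<noteq> 0" "B \<noteq> 0" using M by auto
  have invA: "\<bar>inverse A\<bar> \<le> inverse M" and invB: "\<bar>inverse B\<bar> \<le> inverse M"
    using AM BM M by (auto simp: abs_inverse le_imp_inverse_le)
  \<comment> \<open>The growing parts of \<open>A\<close> and \<open>B\<close> cancel.\<close>
  have AB: "A + B = 2 * pi * \<theta>" by (simp add: A_def B_def algebra_simps)
  have "(of_real (A + \<sigma>) - z) / of_real A * ((of_real (B + \<sigma>') - z) / of_real B) - 1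
      = of_real (\<sigma> * inverse A) + of_real (\<sigma>' * inverse B)
        + (of_real \<sigma> - z) * (of_real \<sigma>' - z) * of_real (inverse A * inverse B)
        - z * of_real (A + B) * of_real (inverse A * inverse B)"
    using nz by (simp add: field_simps)
  also have "norm \<dots> \<le> norm (of_real (\<sigma> * inverse A) :: complex) + norm (of_real (\<sigma>' * inverse B) :: complex)
      + norm ((of_real \<sigma> - z) * (of_real \<sigma>' - z) * of_real (inverse A * inverse B))
      + norm (z * of_real (A + B) * of_real (inverse A * inverse B))"
    by (intro order_trans[OF norm_triangle_ineq4] add_mono order_trans[OF norm_triangle_ineq] order_refl)
  also have "\<dots> \<le> (\<sigma>\<^sup>2 + (inverse M)\<^sup>2) + (\<sigma>'\<^sup>2 + (inverse M)\<^sup>2)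
      + (\<sigma>\<^sup>2 + \<sigma>'\<^sup>2 + 2 * R\<^sup>2 * (inverse M)\<^sup>2) + 4 * R * (inverse M)\<^sup>2"
  proof (intro add_mono)
    have *: "\<bar>s\<bar> * i \<le> s\<^sup>2 + i\<^sup>2" if "0 \<le> i" for s i :: real
      using sum_squares_bound[of "\<bar>s\<bar>" i] mult_nonneg_nonneg[OF abs_ge_zero[of s] that] by simp
    have le: "norm (of_real (s * inverse a) :: complex) \<le> s\<^sup>2 + (inverse M)\<^sup>2" if "\<bar>inverse a\<bar> \<le> inverse M" for s a
    proof -
      have "norm (of_real (s * inverse a) :: complex) = \<bar>s\<bar> * \<bar>inverse a\<bar>"
        unfolding norm_of_real abs_mult ..
      also have "\<dots> \<le> \<bar>s\<bar> * inverse M" by (rule mult_left_mono[OF that]) simp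
      also have "\<dots> \<le> s\<^sup>2 + (inverse M)\<^sup>2" by (rule *) (use M in simp)
      finally show ?thesis .
    qed
    show "norm (of_real (\<sigma> * inverse A) :: complex) \<le> \<sigma>\<^sup>2 + (inverse M)\<^sup>2"
      and "norm (of_real (\<sigma>' * inverse B) :: complex) \<le> \<sigma>'\<^sup>2 + (inverse M)\<^sup>2"
      by (rule le[OF invA], rule le[OF invB])
    have invAB: "\<bar>inverse A * inverse B\<bar> \<le> (inverse M)\<^sup>2"
      unfolding abs_mult power2_eq_square using M by (intro mult_mono invA invB) auto
    have i1: "(inverse M)\<^sup>2 \<le> 1"
      using M by (intro power_le_one) (auto simp: inverse_le_1_iff)
    have R0: "0 \<le> R" using z norm_ge_zero order_trans by blast
    have "norm ((of_real \<sigma> - z) * (of_real \<sigma>' - z)) \<le> (\<bar>\<sigma>\<bar> + R) * (\<bar>\<sigma>'\<bar> + R)"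
      unfolding norm_mult using z R0
      by (intro mult_mono order_trans[OF norm_triangle_ineq4] add_mono) auto
    also have "\<dots> \<le> \<sigma>\<^sup>2 + \<sigma>'\<^sup>2 + 2 * R\<^sup>2"
    proof -
      have "(\<bar>\<sigma>\<bar> + R) * (\<bar>\<sigma>'\<bar> + R) \<le> ((\<bar>\<sigma>\<bar> + R)\<^sup>2 + (\<bar>\<sigma>'\<bar> + R)\<^sup>2) / 2"
        using sum_squares_bound[of "\<bar>\<sigma>\<bar> + R" "\<bar>\<sigma>'\<bar> + R"] by (simp add: algebra_simps)
      moreover have "(\<bar>s\<bar> + R)\<^sup>2 \<le> 2 * s\<^sup>2 + 2 * R\<^sup>2" for s
        using sum_squares_bound[of "\<bar>s\<bar>" R] by (simp add: power2_sum)
      from add_mono[OF this[of \<sigma>] this[of \<sigma>']]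
      have "((\<bar>\<sigma>\<bar> + R)\<^sup>2 + (\<bar>\<sigma>'\<bar> + R)\<^sup>2) / 2 \<le> \<sigma>\<^sup>2 + \<sigma>'\<^sup>2 + 2 * R\<^sup>2" by simp
      ultimately show ?thesis by linarith
    qed
    finally have "norm ((of_real \<sigma> - z) * (of_real \<sigma>' - z)) * \<bar>inverse A * inverse B\<bar>
        \<le> (\<sigma>\<^sup>2 + \<sigma>'\<^sup>2 + 2 * R\<^sup>2) * (inverse M)\<^sup>2"
      by (rule mult_mono[OF _ invAB]) auto
    also have "\<dots> \<le> \<sigma>\<^sup>2 + \<sigma>'\<^sup>2 + 2 * R\<^sup>2 * (inverse M)\<^sup>2"
      using mult_left_mono[OF i1, of "\<sigma>\<^sup>2 + \<sigma>'\<^sup>2"] by (simp add: distrib_right)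
    finally show "norm ((of_real \<sigma> - z) * (of_real \<sigma>' - z) * of_real (inverse A * inverse B))
        \<le> \<sigma>\<^sup>2 + \<sigma>'\<^sup>2 + 2 * R\<^sup>2 * (inverse M)\<^sup>2"
      unfolding norm_mult[of _ "of_real (inverse A * inverse B)"] norm_of_real .
    have "\<bar>A + B\<bar> \<le> 4"
    proof -
      have "\<bar>A + B\<bar> = 2 * pi * \<bar>\<theta>\<bar>" unfolding AB by (simp add: abs_mult)
      also have "\<dots> \<le> 2 * pi * (1 / 2)" by (rule mult_left_mono[OF \<theta>]) simp
      finally show ?thesis using pi_less_4 by simp
    qed
    then have "norm (z * of_real (A + B)) \<le> R * 4"
      unfolding norm_mult norm_of_real using z R0 by (intro mult_mono) auto
    then have "norm (z * of_real (A + B)) * \<bar>inverse A * inverse B\<bar> \<le> R * 4 * (inverse M)\<^sup>2"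
      using R0 by (intro mult_mono invAB) auto
    then show "norm (z * of_real (A + B) * of_real (inverse A * inverse B)) \<le> 4 * R * (inverse M)\<^sup>2"
      unfolding norm_mult[of _ "of_real (inverse A * inverse B)"] norm_of_real by (simp add: mult.commute)
  qed
  also have "\<dots> = 2 * \<sigma>\<^sup>2 + 2 * \<sigma>'\<^sup>2 + (2 + 4 * R + 2 * R\<^sup>2) * (inverse M)\<^sup>2"
    by (simp add: algebra_simps)
  finally show ?thesis by (simp only: A_def B_def)
qed

text \<open>
  The factor at \<open>m = 0\<close> is left out since it is normalised differently for \<open>S\<close> (\<open>\<theta> = 0\<close>) and \<open>C\<close>
  (\<open>\<theta> = 1 / 2\<close>).
\<close>

definition symmetric_product :: "real \<Rightarrow> (int \<Rightarrow> real) \<Rightarrow> nat \<Rightarrow> complex \<Rightarrow> complex" where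
  "symmetric_product \<theta> y N z =
     (\<Prod>m\<in>{- int N..int N} - {0}. (of_real (y m) - z) / of_real (pi * (of_int m + \<theta>)))"

lemma symmetric_product_holomorphic: "symmetric_product \<theta> y N holomorphic_on A"
  unfolding symmetric_product_def[abs_def] by (intro holomorphic_intros) auto

text \<open>
  The factor \<open>q\<close> is for the missing index \<open>0\<close>. Uniform convergence on discs is what allows derivatives
  to pass to the limit.
\<close>

lemma symmetric_product_uniform_limit:
  fixes q :: "complex \<Rightarrow> complex"
  assumes \<theta>: "\<bar>\<theta>\<bar> \<le> 1 / 2"
    and sq: "(\<lambda>m. (y m - pi * (of_int m + \<theta>))\<^sup>2) summable_on UNIV"
    and q: "continuous_on UNIV q"
  shows "uniform_limit (cball 0 R) (\<lambda>N z. q z * symmetric_product \<theta> y N z)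
    (\<lambda>z. q z * lim (\<lambda>N. symmetric_product \<theta> y N z)) sequentially"
proof -
  define \<sigma> where "\<sigma> m = y m - pi * (of_int m + \<theta>)" for m
  have y: "y m = pi * (of_int m + \<theta>) + \<sigma> m" for m by (simp add: \<sigma>_def)
  define p where "p m z = (of_real (y (int m + 1)) - z) / of_real (pi * (of_int (int m + 1) + \<theta>)) *
     ((of_real (y (- (int m + 1))) - z) / of_real (pi * (of_int (- (int m + 1)) + \<theta>)))" for m and z :: complex
  have prod: "symmetric_product \<theta> y N z = (\<Prod>m<N. p m z)" for N z
    unfolding symmetric_product_def p_def by (rule prod_symmetric_interval)
  have summ: "summable (\<lambda>m. f (g m))" if "f summable_on UNIV" "inj g" for f :: "int \<Rightarrow> real" and g :: "nat \<Rightarrow> int"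
  proof -
    have "f summable_on range g" using that(1) by (rule summable_on_subset) auto
    then show ?thesis using summable_on_reindex[OF that(2), of f]
      by (intro summable_on_imp_summable) (simp add: o_def)
  qed
  define b where "b m = 2 * (\<sigma> (int m + 1))\<^sup>2 + 2 * (\<sigma> (- (int m + 1)))\<^sup>2
      + (2 + 4 * R + 2 * R\<^sup>2) * (recip (int m + 1))\<^sup>2" for m
  have "summable b"
    unfolding b_def
    by (intro summable_add summable_mult summ[where f = "\<lambda>m. (\<sigma> m)\<^sup>2"] summ[where f = "\<lambda>m. (recip m)\<^sup>2"]
        summable_recip_square sq[folded \<sigma>_def]) (auto simp: inj_on_def)
  have p_le: "norm (p m z - 1) \<le> b m" if "z \<in> cball 0 R" for m z
    unfolding p_def y b_def
    using paired_factor_deviation[of "of_int (int m + 1)" \<theta> z R "\<sigma> (int m + 1)" "\<sigma> (- (int m + 1))"] \<theta> that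
    by simp
  have p_cont: "continuous_on A (p m)" for A m
    unfolding p_def divide_inverse by (intro continuous_intros)
  have "uniformly_convergent_on (cball 0 R) (\<lambda>N z. \<Prod>m<N. p m z)"
  proof (rule uniformly_convergent_on_prod')
    show "uniformly_convergent_on (cball 0 R) (\<lambda>N z. \<Sum>m<N. norm (p m z - 1))"
      by (rule Weierstrass_m_test'[OF _ \<open>summable b\<close>]) (use p_le in auto)
  qed (auto intro: p_cont)
  then have lim: "uniform_limit (cball 0 R) (symmetric_product \<theta> y)
      (\<lambda>z. lim (\<lambda>N. symmetric_product \<theta> y N z)) sequentially"
    unfolding uniformly_convergent_uniform_limit_iff by (simp add: prod[abs_def])
  have cont: "continuous_on (cball 0 R) (\<lambda>z. lim (\<lambda>N. symmetric_product \<theta> y N z))"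
    by (rule uniform_limit_theorem[OF _ lim])
       (auto intro!: always_eventually holomorphic_on_imp_continuous_on symmetric_product_holomorphic)
  have bdd: "bounded (f ` cball 0 R)" if "continuous_on (cball 0 R) f" for f :: "complex \<Rightarrow> complex"
    by (rule compact_imp_bounded[OF compact_continuous_image[OF that]]) simp
  show ?thesis
    by (rule uniform_lim_mult[OF uniform_limit_const lim])
       (intro bdd cont continuous_on_subset[OF q] subset_UNIV)+
qed

lemma prod_int_interval_shift:
  fixes g :: "int \<Rightarrow> real"
  assumes "a \<le> b"
  shows "(\<Prod>k\<in>{a..b}. g (k - 1)) * g b = (\<Prod>k\<in>{a..b}. g k) * g (a - 1)"
proof -
  have "(\<Prod>k\<in>{a..b}. g (k - 1)) = prod g {a - 1..b - 1}"
    by (rule prod.reindex_bij_witness[of _ "\<lambda>k. k + 1" "\<lambda>k. k - 1"]) auto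
  moreover have "insert b {a - 1..b - 1} = insert (a - 1) {a..b}" using assms by auto
  then have "prod g (insert b {a - 1..b - 1}) = prod g (insert (a - 1) {a..b})" by simp
  ultimately show ?thesis by (simp add: mult.commute)
qed

text \<open>
  This is the unperturbed product, with value \<open>sin' (\<pi> n) cos (\<pi> n) = 1\<close> for \<open>j = 2 n\<close>. Moving the
  centre by one step multiplies the ratio by a quotient of two end factors, which tends to \<open>- 1\<close>.
\<close>

lemma window_ratio_tendsto:
  defines "g \<equiv> \<lambda>k :: int. if k = 0 then 1 else pi / 2 * real_of_int k"
  shows "(\<lambda>N. (\<Prod>k\<in>window N. g (k - j)) / (\<Prod>k\<in>window N. g k)) \<longlonglongrightarrow> (if even j then 1 else - 1)"
proof -
  define s where "s j N = (\<Prod>k\<in>window N. g (k - j)) / (\<Prod>k\<in>window N. g k)" for j N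
  define e where "e j N = g (- (2 * int N) - 1 - j) / g (2 * int N + 1 - j)" for j N
  have g0: "g k \<noteq> 0" for k by (simp add: g_def)
  have step: "s (j + 1) = (\<lambda>N. s j N * e j N)" for j
  proof
    fix N
    have "(\<Prod>k\<in>window N. g (k - 1 - j)) * g (2 * int N + 1 - j)
        = (\<Prod>k\<in>window N. g (k - j)) * g (- (2 * int N) - 1 - j)"
      using prod_int_interval_shift[of "- (2 * int N)" "2 * int N + 1" "\<lambda>k. g (k - j)"] by simp
    moreover have "k - (j + 1) = k - 1 - j" for k by simp
    ultimately show "s (j + 1) N = s j N * e j N"
      using g0 by (simp add: s_def e_def field_simps)
  qed
  have lim: "e j \<longlonglongrightarrow> - 1" for j
  proof (rule tendsto_cong[THEN iffD1])
    show "(\<lambda>N. (- (2 * real N) - 1 - real_of_int j) / (2 * real N + 1 - real_of_int j)) \<longlonglongrightarrow> - 1"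
      by real_asymp
    show "\<forall>\<^sub>F N in sequentially. (- (2 * real N) - 1 - real_of_int j) / (2 * real N + 1 - real_of_int j) = e j N"
      by (rule eventually_sequentiallyI[of "nat \<bar>j\<bar> + 1"]) (auto simp: e_def g_def)
  qed
  have "s j \<longlonglongrightarrow> (if even j then 1 else - 1)"
  proof (induction j rule: int_induct[of _ 0])
    case base
    then show ?case using g0 by (simp add: s_def[abs_def] prod_zero_iff)
  next
    case (step1 i)
    from tendsto_mult[OF step1(2) lim[of i]] show ?case by (simp add: step split: if_splits)
  next
    case (step2 i)
    have "s (i - 1) = (\<lambda>N. s i N / e (i - 1) N)"
      using step[of "i - 1"] g0 by (simp add: e_def)
    with tendsto_divide[OF step2(2) lim[of "i - 1"]] show ?case by (simp split: if_splits)
  qed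
  then show ?thesis by (simp add: s_def[abs_def])
qed

text \<open>
  In finite windows the product is the exponential of its linear part plus its defects. The part of
  the linear sum that belongs to the entry at \<open>j\<close> tends to \<open>0\<close>, the rest to the Hilbert transform.
\<close>

lemma window_product_tendsto:
  assumes c: "0 < c" "c \<le> 1" and x: "x \<in> factors_ge c"
  shows "(\<lambda>N. \<Prod>k\<in>window N. 1 + ell2_nth (difference_quotients x) (j, k)) \<longlonglongrightarrow> exp (log_product x j)"
proof -
  let ?u = "\<lambda>k. ell2_nth (difference_quotients x) (j, k)"
  have pos: "0 < 1 + ?u k" for k using factors_geD[OF x, of "(j, k)"] c(1) by linarith
  have prod: "(\<Prod>k\<in>window N. 1 + ?u k) = exp (2 / pi * ((\<Sum>k\<in>window N. ell2_nth x k * recip (k - j))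
      - ell2_nth x j * (\<Sum>k\<in>window N. recip (k - j))) + (\<Sum>k\<in>window N. log_defect (?u k)))" for N
  proof -
    have "(\<Prod>k\<in>window N. 1 + ?u k) = (\<Prod>k\<in>window N. exp (?u k + log_defect (?u k)))"
      using pos by (intro prod.cong) (simp_all add: log_defect_def)
    also have "\<dots> = exp ((\<Sum>k\<in>window N. ?u k) + (\<Sum>k\<in>window N. log_defect (?u k)))"
      by (simp add: exp_sum[symmetric] sum.distrib)
    also have "(\<Sum>k\<in>window N. ?u k) = 2 / pi * ((\<Sum>k\<in>window N. ell2_nth x k * recip (k - j))
        - ell2_nth x j * (\<Sum>k\<in>window N. recip (k - j)))"
      unfolding difference_quotients_nth sum_distrib_left sum_subtractf[symmetric]
      by (intro sum.cong) (simp_all add: algebra_simps)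
    finally show ?thesis .
  qed
  have "(\<lambda>N. exp (2 / pi * ((\<Sum>k\<in>window N. ell2_nth x k * recip (k - j))
      - ell2_nth x j * (\<Sum>k\<in>window N. recip (k - j))) + (\<Sum>k\<in>window N. log_defect (?u k))))
    \<longlonglongrightarrow> exp (2 / pi * (ell2_nth (hilbert_transform x) j - ell2_nth x j * 0) + (\<Sum>\<^sub>\<infinity>k. log_defect (?u k)))"
    by (intro tendsto_intros has_sum_imp_window_limit[OF hilbert_transform_nth] recip_window_sum_tendsto_zero
        has_sum_imp_window_limit[OF has_sum_infsum[OF log_defect_row_summable[OF c x]]])
  then show ?thesis unfolding prod by (simp add: log_product_def)
qed

section \<open>Spectral data and their norming constants\<close>

lemma window_prod_split:
  fixes f :: "int \<Rightarrow> 'a::comm_monoid_mult"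
  shows "(\<Prod>k\<in>window N - {2 * n}. f k)
    = (\<Prod>m\<in>{- int N..int N} - {n}. f (2 * m)) * (\<Prod>m\<in>{- int N..int N}. f (2 * m + 1))"
proof -
  have "window N - {2 * n} = (\<lambda>m. 2 * m) ` ({- int N..int N} - {n}) \<union> (\<lambda>m. 2 * m + 1) ` {- int N..int N}"
  proof (intro equalityI subsetI)
    fix k assume k: "k \<in> window N - {2 * n}"
    show "k \<in> (\<lambda>m. 2 * m) ` ({- int N..int N} - {n}) \<union> (\<lambda>m. 2 * m + 1) ` {- int N..int N}"
    proof (cases "even k")
      case True
      then obtain m where "k = 2 * m" by blast
      then show ?thesis using k by auto
    next
      case False
      then obtain m where "k = 2 * m + 1" by (blast elim: oddE)
      then show ?thesis using k by auto
    qed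
  qed (auto, presburger)
  moreover have "(\<lambda>m. 2 * m) ` ({- int N..int N} - {n}) \<inter> (\<lambda>m. 2 * m + 1) ` {- int N..int N} = {}"
    by (auto simp: image_def) presburger
  ultimately show ?thesis
    by (simp add: prod.union_disjoint prod.reindex inj_on_def)
qed

text \<open>
  The interleaved sequence \<open>\<dots>, \<lambda> 0, \<mu> 0, \<lambda> 1, \<mu> 1, \<dots>\<close>.
\<close>

definition spectral_position :: "spectral_pair \<Rightarrow> int \<Rightarrow> real" where
  "spectral_position \<nu> k = pi / 2 * of_int k + rho_seq \<nu> k"

lemma spectral_position_even: "spectral_position \<nu> (2 * n) = fst \<nu> n"
  and spectral_position_odd: "spectral_position \<nu> (2 * n + 1) = snd \<nu> n"
  unfolding spectral_position_def rho_seq_even rho_seq_odd by (simp_all add: algebra_simps)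

lemma spectral_ell2_nth: "\<nu> \<in> spectral_data \<Longrightarrow> ell2_nth (spectral_ell2 \<nu>) = rho_seq \<nu>"
  by (simp add: spectral_ell2_def spectral_data_def Abs_ell2_inverse)

lemma spectral_position_difference:
  assumes "\<nu> \<in> spectral_data"
  defines "g \<equiv> \<lambda>k :: int. if k = 0 then 1 else pi / 2 * real_of_int k"
  assumes "k \<noteq> j"
  shows "spectral_position \<nu> k - spectral_position \<nu> j
    = g (k - j) * (1 + ell2_nth (difference_quotients (spectral_ell2 \<nu>)) (j, k))"
  using assms(3)
  by (simp add: difference_quotients_nth spectral_ell2_nth[OF assms(1)] spectral_position_def g_def field_simps)

text \<open>
  Neighbouring positions are at least \<open>h\<close> apart, so the positions with indices \<open>j\<close> and \<open>k\<close> are at least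
  \<open>h \<bar>k - j\<bar>\<close> apart. The entries with \<open>j = k\<close> are \<open>0\<close> by convention, which is where \<open>h \<le> \<pi> / 2\<close> enters.
\<close>

lemma separated_imp_factors_ge:
  assumes \<nu>: "\<nu> \<in> separated_spectral_data h r" and "0 < h" "h \<le> pi / 2"
  shows "spectral_ell2 \<nu> \<in> factors_ge (2 * h / pi)"
proof -
  let ?x = "spectral_position \<nu>" and ?u = "difference_quotients (spectral_ell2 \<nu>)"
  have sd: "\<nu> \<in> spectral_data"
    and sep: "\<And>n. h \<le> snd \<nu> n - fst \<nu> n" "\<And>n. h \<le> fst \<nu> (n + 1) - snd \<nu> n"
    using \<nu> by (auto simp: separated_spectral_data_def)
  have step: "h \<le> ?x (k + 1) - ?x k" for k
  proof (cases "even k")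
    case True
    then obtain n where "k = 2 * n" by blast
    then show ?thesis using sep(1)[of n] by (simp add: spectral_position_even spectral_position_odd)
  next
    case False
    then obtain n where k: "k = 2 * n + 1" by (blast elim: oddE)
    then have "k + 1 = 2 * (n + 1)" by simp
    then show ?thesis using sep(2)[of n] k by (simp only: spectral_position_even spectral_position_odd)
  qed
  have gap: "h * of_int (k - j) \<le> ?x k - ?x j" if "j \<le> k" for j k
    using that
  proof (induction k rule: int_ge_induct)
    case (step i)
    then show ?case using \<open>\<And>k. h \<le> ?x (k + 1) - ?x k\<close>[of i] by (simp add: algebra_simps)
  qed simp
  have factor: "2 * h / pi \<le> 1 + ell2_nth ?u (j, k)" for j k
  proof (cases "k = j")
    case True
    then show ?thesis using \<open>h \<le> pi / 2\<close> by (simp add: difference_quotients_nth field_simps)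
  next
    case False
    have "?x k - ?x j = pi / 2 * of_int (k - j) * (1 + ell2_nth ?u (j, k))"
      using spectral_position_difference[OF sd False] False by simp
    then have eq: "1 + ell2_nth ?u (j, k) = 2 / pi * ((?x k - ?x j) / of_int (k - j))"
      using False by (simp add: field_simps)
    have "h \<le> (?x k - ?x j) / of_int (k - j)"
      using gap[of j k] gap[of k j] False
      by (cases "j < k") (auto simp: le_divide_eq algebra_simps)
    then have "2 / pi * h \<le> 2 / pi * ((?x k - ?x j) / of_int (k - j))"
      by (rule mult_left_mono) simp
    then show ?thesis unfolding eq by simp
  qed
  then show ?thesis by (auto simp: factors_ge_def)
qed

text \<open>
  The product rule leaves of the derivative of the partial product for \<open>S\<close> at its zero \<open>\<lambda> n\<close> only the
  product of the other factors. Together with the partial product for \<open>C\<close> these are the factors over the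
  window without the index \<open>2 n\<close>, divided by the unperturbed factors over the window without \<open>0\<close>.
\<close>

lemma norming_denominator_finite:
  assumes \<nu>: "\<nu> \<in> spectral_data" and N: "n \<in> {- int N..int N}"
  defines "g \<equiv> \<lambda>k :: int. if k = 0 then 1 else pi / 2 * real_of_int k"
  shows "deriv (\<lambda>z. (z - of_real (fst \<nu> 0)) * symmetric_product 0 (fst \<nu>) N z) (of_real (fst \<nu> n)) *
      ((of_real (snd \<nu> 0) - of_real (fst \<nu> n)) / of_real (pi * (1 / 2))
        * symmetric_product (1 / 2) (snd \<nu>) N (of_real (fst \<nu> n)))
    = complex_of_real ((\<Prod>k\<in>window N. g (k - 2 * n)) / (\<Prod>k\<in>window N. g k)
        * (\<Prod>k\<in>window N. 1 + ell2_nth (difference_quotients (spectral_ell2 \<nu>)) (2 * n, k)))"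
proof -
  let ?I = "{- int N..int N}" and ?lam = "fst \<nu>" and ?mu = "snd \<nu>" and ?x = "spectral_position \<nu>"
  let ?u = "\<lambda>k. ell2_nth (difference_quotients (spectral_ell2 \<nu>)) (2 * n, k)"
  \<comment> \<open>The partial product for \<open>S\<close> with its factor \<open>z - \<lambda> n\<close> removed.\<close>
  define T where "T z = (\<Prod>m\<in>?I - {n}. of_real (?lam m) - z) / (\<Prod>m\<in>?I - {0}. complex_of_real (pi * of_int m))" for z
  have zero: "0 \<in> ?I" by simp
  have "(z - of_real (?lam 0)) * symmetric_product 0 ?lam N z = (z - of_real (?lam n)) * T z" for z
  proof -
    have "(\<Prod>m\<in>?I. of_real (?lam m) - z) = (of_real (?lam a) - z) * (\<Prod>m\<in>?I - {a}. of_real (?lam m) - z)"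
      if "a \<in> ?I" for a by (rule prod.remove) (use that in auto)
    from this[OF zero] this[OF N]
    have "(of_real (?lam 0) - z) * (\<Prod>m\<in>?I - {0}. of_real (?lam m) - z)
        = (of_real (?lam n) - z) * (\<Prod>m\<in>?I - {n}. of_real (?lam m) - z)" by simp
    moreover have "(z - w) * P = - ((w - z) * P)" for w P by (simp add: algebra_simps)
    ultimately have "(z - of_real (?lam 0)) * (\<Prod>m\<in>?I - {0}. of_real (?lam m) - z)
        = (z - of_real (?lam n)) * (\<Prod>m\<in>?I - {n}. of_real (?lam m) - z)"
      by (simp only:)
    then show ?thesis
      by (simp add: symmetric_product_def T_def prod_dividef)
  qed
  moreover have "((\<lambda>z. (z - of_real (?lam n)) * T z) has_field_derivative T (of_real (?lam n))) (at (of_real (?lam n)))"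
  proof -
    have "T holomorphic_on UNIV"
      unfolding T_def[abs_def] by (intro holomorphic_intros) (auto simp: prod_zero_iff)
    then obtain D where "(T has_field_derivative D) (at (of_real (?lam n)))"
      by (metis UNIV_I field_differentiable_def holomorphic_on_def)
    from DERIV_mult[OF DERIV_diff[OF DERIV_ident DERIV_const] this, of "of_real (?lam n)"]
    show ?thesis by simp
  qed
  ultimately have deriv: "deriv (\<lambda>z. (z - of_real (?lam 0)) * symmetric_product 0 ?lam N z) (of_real (?lam n)) = T (of_real (?lam n))"
    by (simp add: DERIV_imp_deriv)
  have C: "(of_real (?mu 0) - z) / of_real (pi * (1 / 2)) * symmetric_product (1 / 2) ?mu N z
      = (\<Prod>m\<in>?I. of_real (?mu m) - z) / (\<Prod>m\<in>?I. complex_of_real (pi * (of_int m + 1 / 2)))" for z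
  proof -
    have "(\<Prod>m\<in>?I. (of_real (?mu m) - z) / complex_of_real (pi * (of_int m + 1 / 2)))
      = (of_real (?mu 0) - z) / of_real (pi * (1 / 2)) * symmetric_product (1 / 2) ?mu N z"
      unfolding symmetric_product_def by (subst prod.remove[OF _ zero]) simp_all
    then show ?thesis by (simp add: prod_dividef)
  qed
  have num: "(\<Prod>m\<in>?I - {n}. of_real (?lam m) - complex_of_real (?lam n)) * (\<Prod>m\<in>?I. of_real (?mu m) - complex_of_real (?lam n))
      = of_real (\<Prod>k\<in>window N - {2 * n}. ?x k - ?x (2 * n))"
    by (simp add: window_prod_split spectral_position_even spectral_position_odd)
  have "(\<Prod>k\<in>window N - {2 * n}. ?x k - ?x (2 * n)) = (\<Prod>k\<in>window N - {2 * n}. g (k - 2 * n) * (1 + ?u k))"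
    using spectral_position_difference[OF \<nu>, of _ "2 * n"] by (intro prod.cong) (auto simp: g_def)
  also have "\<dots> = (\<Prod>k\<in>window N. g (k - 2 * n) * (1 + ?u k))"
    by (rule prod.mono_neutral_left) (auto simp: g_def difference_quotients_nth)
  finally have num': "(\<Prod>k\<in>window N - {2 * n}. ?x k - ?x (2 * n))
      = (\<Prod>k\<in>window N. g (k - 2 * n)) * (\<Prod>k\<in>window N. 1 + ?u k)"
    by (simp add: prod.distrib)
  have g_odd: "g (2 * m + 1) = pi * (of_int m + 1 / 2)" for m
  proof -
    have "2 * m + 1 \<noteq> 0" by presburger
    then show ?thesis by (simp add: g_def algebra_simps)
  qed
  have "(\<Prod>k\<in>window N. g k) = (\<Prod>k\<in>window N - {2 * 0}. g k)"
    by (rule prod.mono_neutral_right) (auto simp: g_def)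
  also have "\<dots> = (\<Prod>m\<in>?I - {0}. pi * of_int m) * (\<Prod>m\<in>?I. pi * (of_int m + 1 / 2))"
    unfolding window_prod_split
    by (intro arg_cong2[where f = times] prod.cong refl g_odd) (simp add: g_def)
  finally have den: "(\<Prod>m\<in>?I - {0}. complex_of_real (pi * of_int m)) * (\<Prod>m\<in>?I. complex_of_real (pi * (of_int m + 1 / 2)))
      = of_real (\<Prod>k\<in>window N. g k)" by simp
  show ?thesis
    unfolding deriv C T_def times_divide_times_eq num num' den by simp
qed

text \<open>
  Let the partial products tend to their limits: derivatives converge because the convergence is locally
  uniform, and the finite products converge to the exponential of the logarithm computed above.
\<close>

lemma norming_const_eq:
  assumes c: "0 < c" "c \<le> 1" and \<nu>: "\<nu> \<in> spectral_data" and x: "spectral_ell2 \<nu> \<in> factors_ge c"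
  shows "norming_const \<nu> n = complex_of_real (exp (- log_product (spectral_ell2 \<nu>) (2 * n)))"
proof -
  let ?lam = "fst \<nu>" and ?mu = "snd \<nu>"
  let ?S = "\<lambda>N z. (z - of_real (?lam 0)) * symmetric_product 0 ?lam N z"
  let ?C = "\<lambda>N z. (of_real (?mu 0) - z) / complex_of_real (pi * (1 / 2)) * symmetric_product (1 / 2) ?mu N z"
  define a where "a = complex_of_real (?lam n)"
  define R where "R = norm a + 1"
  have a: "a \<in> ball 0 R" by (simp add: R_def)
  have sq: "(\<lambda>m. (rho_seq \<nu> (g m))\<^sup>2) summable_on UNIV" if "inj g" for g :: "int \<Rightarrow> int"
    using ell2_nth_summable[of "ell2_reindex g (spectral_ell2 \<nu>)"] that
    by (simp add: ell2_reindex_nth spectral_ell2_nth[OF \<nu>])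
  have "uniform_limit (cball 0 R) ?S (\<lambda>z. (z - of_real (?lam 0)) * lim (\<lambda>N. symmetric_product 0 ?lam N z)) sequentially"
    using sq[OF inj_double]
    by (intro symmetric_product_uniform_limit continuous_intros) (simp_all add: rho_seq_even)
  moreover have "(\<lambda>z. (z - of_real (?lam 0)) * lim (\<lambda>N. symmetric_product 0 ?lam N z)) = S_fun \<nu>"
    by (simp add: fun_eq_iff S_fun_def symmetric_product_def)
  ultimately have "uniform_limit (ball 0 R) ?S (S_fun \<nu>) sequentially"
    using uniform_limit_on_subset ball_subset_cball by metis
  moreover have "?S N holomorphic_on ball 0 R" for N
    by (intro holomorphic_intros symmetric_product_holomorphic)
  ultimately have lim_S: "(\<lambda>N. deriv (?S N) a) \<longlonglongrightarrow> deriv (S_fun \<nu>) a"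
    by (intro deriv_complex_uniform_limit[OF _ _ _ open_ball a]) auto
  have "inj (\<lambda>m :: int. 2 * m + 1)" by (simp add: inj_on_def)
  from sq[OF this]
  have "uniform_limit (cball 0 R) ?C (\<lambda>z. (of_real (?mu 0) - z) / complex_of_real (pi * (1 / 2))
      * lim (\<lambda>N. symmetric_product (1 / 2) ?mu N z)) sequentially"
    by (intro symmetric_product_uniform_limit continuous_intros) (simp_all add: rho_seq_odd)
  from tendsto_uniform_limitI[OF this, of a]
  have "(\<lambda>N. ?C N a) \<longlonglongrightarrow> (of_real (?mu 0) - a) / complex_of_real (pi * (1 / 2))
      * lim (\<lambda>N. symmetric_product (1 / 2) ?mu N a)" (is "_ \<longlonglongrightarrow> ?L")
    using a by simp
  moreover have "?C N a = (\<Prod>m\<in>{- int N..int N}. (of_real (?mu m) - a) / of_real (pi * (of_int m + 1 / 2)))" for N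
    unfolding symmetric_product_def by (subst prod.remove[of _ 0]) simp_all
  ultimately have lim_C: "(\<lambda>N. ?C N a) \<longlonglongrightarrow> C_fun \<nu> a"
    unfolding C_fun_def by (simp add: limI)
  let ?g = "\<lambda>k :: int. if k = 0 then 1 else pi / 2 * real_of_int k"
  have "(\<lambda>N. complex_of_real ((\<Prod>k\<in>window N. ?g (k - 2 * n)) / (\<Prod>k\<in>window N. ?g k)
      * (\<Prod>k\<in>window N. 1 + ell2_nth (difference_quotients (spectral_ell2 \<nu>)) (2 * n, k))))
    \<longlonglongrightarrow> of_real ((if even (2 * n) then 1 else - 1) * exp (log_product (spectral_ell2 \<nu>) (2 * n)))"
    by (intro tendsto_of_real tendsto_mult window_ratio_tendsto window_product_tendsto[OF c x])
  moreover have "\<forall>\<^sub>F N in sequentially. complex_of_real ((\<Prod>k\<in>window N. ?g (k - 2 * n)) / (\<Prod>k\<in>window N. ?g k)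
      * (\<Prod>k\<in>window N. 1 + ell2_nth (difference_quotients (spectral_ell2 \<nu>)) (2 * n, k)))
      = deriv (?S N) a * ?C N a"
  proof (rule eventually_sequentiallyI[of "nat \<bar>n\<bar>"])
    fix N assume "nat \<bar>n\<bar> \<le> N"
    then have "n \<in> {- int N..int N}" by auto
    from norming_denominator_finite[OF \<nu> this] show "complex_of_real ((\<Prod>k\<in>window N. ?g (k - 2 * n)) / (\<Prod>k\<in>window N. ?g k)
      * (\<Prod>k\<in>window N. 1 + ell2_nth (difference_quotients (spectral_ell2 \<nu>)) (2 * n, k)))
      = deriv (?S N) a * ?C N a" unfolding a_def by (rule sym)
  qed
  ultimately have "(\<lambda>N. deriv (?S N) a * ?C N a) \<longlonglongrightarrow> of_real (exp (log_product (spectral_ell2 \<nu>) (2 * n)))"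
    using tendsto_cong by fastforce
  from LIMSEQ_unique[OF tendsto_mult[OF lim_S lim_C] this]
  have "deriv (S_fun \<nu>) a * C_fun \<nu> a = of_real (exp (log_product (spectral_ell2 \<nu>) (2 * n)))" .
  then show ?thesis
    by (simp add: norming_const_def flip: a_def) (simp add: exp_minus divide_inverse)
qed

theorem theorem4p1:
  fixes h r :: real
  assumes "0 < h" and "h < pi / 2" and "0 < r"
  shows "(\<forall>\<nu>\<in>separated_spectral_data h r.
            (\<forall>n. complex_of_real (norming_seq \<nu> n) = norming_const \<nu> n) \<and>
            norming_seq \<nu> \<in> norming_sequences)
       \<and> analytic_map_on (spectral_ell2 ` separated_spectral_data h r) norming_map_ell2
       \<and> (\<exists>L. L-lipschitz_on (spectral_ell2 ` separated_spectral_data h r) norming_map_ell2)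
       \<and> (\<exists>h'>0. \<exists>r'>0. norming_seq ` separated_spectral_data h r
                          \<subseteq> bounded_norming_sequences h' r')"
proof -
  define c where "c = 2 * h / pi"
  have c: "0 < c" "c \<le> 1" using assms by (simp_all add: c_def)
  let ?N = "separated_spectral_data h r"
  let ?L = "log_product_lipschitz c r"
  have sd: "\<nu> \<in> spectral_data" and le: "norm (spectral_ell2 \<nu>) \<le> r" if "\<nu> \<in> ?N" for \<nu>
    using that by (auto simp: separated_spectral_data_def)
  have fac: "spectral_ell2 \<nu> \<in> factors_ge c" if "\<nu> \<in> ?N" for \<nu>
    using separated_imp_factors_ge[OF that] assms by (simp add: c_def)
  have const: "norming_const \<nu> n = of_real (exp (- log_product (spectral_ell2 \<nu>) (2 * n)))" if "\<nu> \<in> ?N" for \<nu> n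
    by (rule norming_const_eq[OF c sd[OF that] fac[OF that]])
  then have seq: "norming_seq \<nu> n = exp (- log_product (spectral_ell2 \<nu>) (2 * n))" if "\<nu> \<in> ?N" for \<nu> n
    using that by (simp add: norming_seq_def)
  have mem: "norming_seq \<nu> \<in> norming_sequences" if "\<nu> \<in> ?N" for \<nu>
    using exp_neg_log_product_nth(1)[OF c fac[OF that]] by (simp add: norming_sequences_def seq[OF that])
  have ell2: "norming_ell2 (norming_seq \<nu>) = exp_neg_log_product (spectral_ell2 \<nu>)" if "\<nu> \<in> ?N" for \<nu>
    by (simp add: norming_ell2_def exp_neg_log_product_def seq[OF that])
  have map: "norming_map_ell2 x = exp_neg_log_product x" if "x \<in> spectral_ell2 ` ?N" for x
    using that ell2 norming_map_ell2_spectral_ell2[OF sd] by auto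
  have L0: "0 \<le> ?L" using c assms by (intro log_product_lipschitz_nonneg) auto
  have "analytic_map_on (spectral_ell2 ` ?N) norming_map_ell2"
    unfolding analytic_map_on_def
  proof
    fix a assume "a \<in> spectral_ell2 ` ?N"
    then have "a \<in> factors_ge c" using fac by auto
    from exp_neg_log_product_power_series[OF c this] obtain \<delta> F where "0 < \<delta>"
      and "power_series_on_ball F a \<delta>" and "\<forall>x\<in>ball a \<delta>. F x = exp_neg_log_product x" by blast
    then show "\<exists>\<delta>>0. \<exists>F. power_series_on_ball F a \<delta> \<and>
        (\<forall>x\<in>spectral_ell2 ` ?N \<inter> ball a \<delta>. norming_map_ell2 x = F x)"
      using map by (metis IntD1 IntD2)
  qed
  moreover have "(exp (?L * r) * ?L)-lipschitz_on (spectral_ell2 ` ?N) norming_map_ell2"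
  proof (rule lipschitz_onI)
    fix x y assume xy: "x \<in> spectral_ell2 ` ?N" "y \<in> spectral_ell2 ` ?N"
    then have "x \<in> factors_ge c" "norm x \<le> r" "y \<in> factors_ge c" "norm y \<le> r" using fac le by auto
    from exp_neg_log_product_lipschitz[OF c this]
    show "dist (norming_map_ell2 x) (norming_map_ell2 y) \<le> exp (?L * r) * ?L * dist x y"
      by (simp add: map[OF xy(1)] map[OF xy(2)] dist_norm)
  qed (simp add: L0)
  \<comment> \<open>The summand \<open>1\<close> keeps the radius positive even if the Lipschitz constant is \<open>0\<close>.\<close>
  moreover have "norming_seq ` ?N \<subseteq> bounded_norming_sequences (exp (- (?L * r))) (exp (?L * r) * ?L * r + 1)"
  proof (rule image_subsetI)
    fix \<nu> assume \<nu>: "\<nu> \<in> ?N"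
    have "exp (- (?L * r)) \<le> norming_seq \<nu> n" for n
      using log_product_bound[OF c fac[OF \<nu>] le[OF \<nu>], of "2 * n"] by (simp add: seq[OF \<nu>])
    moreover have "norm (norming_ell2 (norming_seq \<nu>)) \<le> exp (?L * r) * ?L * r + 1"
    proof -
      have "exp_neg_log_product 0 = 0"
        by (rule ell2_eqI)
          (simp add: exp_neg_log_product_nth(2)[OF c zero_in_factors_ge[OF c(2)]] log_product_zero zero_ell2.rep_eq)
      then have "norm (exp_neg_log_product (spectral_ell2 \<nu>)) \<le> exp (?L * r) * ?L * norm (spectral_ell2 \<nu>)"
        using exp_neg_log_product_lipschitz[OF c fac[OF \<nu>] le[OF \<nu>] zero_in_factors_ge[OF c(2)]] assms by simp
      also have "\<dots> \<le> exp (?L * r) * ?L * r"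
        using L0 by (intro mult_left_mono le[OF \<nu>]) auto
      finally show ?thesis by (simp add: ell2[OF \<nu>])
    qed
    ultimately show "norming_seq \<nu> \<in> bounded_norming_sequences (exp (- (?L * r))) (exp (?L * r) * ?L * r + 1)"
      using mem[OF \<nu>] by (simp add: bounded_norming_sequences_def)
  qed
  moreover have "0 < exp (?L * r) * ?L * r + 1"
    using L0 assms by (intro add_nonneg_pos) auto
  ultimately show ?thesis
    using const mem seq by (metis exp_gt_zero)
qed

end
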